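(* Each of the two sets $\{Y_{S_1},Y_{C_3},Y_{S_5},Y_{S_7},\dots\}$ and $\{Y_{S_1},Y_{S_3},Y_{S_5},Y_{S_7},\dots\}$ is algebraically independent over $\mathbb{Q}$ and generates $\Gamma$, i.e. $$\Gamma=\mathbb{Q}[Y_{S_1},Y_{C_3},Y_{S_5},Y_{S_7},\dots]=\mathbb{Q}[Y_{S_1},Y_{S_3},Y_{S_5},Y_{S_7},\dots].$$ Moreover, these are the only algebraically independent generating sets of $\Gamma$ consisting of near chromatic symmetric functions $Y_G$ of finite simple graphs $G$.
   Context: For a finite simple graph $G$, $X_G$ is its chromatic symmetric function (the sum over proper colorings $\kappa$ of $\prod_v x_{\kappa(v)}$), $\omega$ is the involution on symmetric functions with $\omega(p_r)=(-1)^{r-1}p_r$, and $Y_G=(X_G+\omega(X_G))/2$ is the near chromatic symmetric function. $\Gamma=\mathbb{Q}[p_1,p_3,p_5,\dots]$ where $p_r$ are power sums. $C_3$ is the cycle on three vertices and $S_n$ is the tree on $n$ vertices with one internal vertex and $n-1$ leaves. *)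

theory Defs
  imports Complex_Main "HOL-Library.Multiset" "HOL-Library.FuncSet"
begin

text \<open>Symmetric functions are modelled as formal power series in countably many
commuting variables x_0, x_1, ... with rational coefficients: a series is the
function sending a monomial (a multiset of variable indices) to its coefficient.\<close>

type_synonym sf = "nat multiset \<Rightarrow> rat"

definition sf_one :: sf where
  "sf_one M = (if M = {#} then 1 else 0)"

definition sf_mult :: "sf \<Rightarrow> sf \<Rightarrow> sf" where
  "sf_mult f g M = (\<Sum>N\<in>{N. N \<subseteq># M}. f N * g (M - N))"

definition sf_mprod :: "sf multiset \<Rightarrow> sf" where
  "sf_mprod m = fold_mset sf_mult sf_one m"

definition psum :: "nat \<Rightarrow> sf" where
  "psum r M = (if 0 < r \<and> (\<exists>i. M = replicate_mset r i) then 1 else 0)"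

definition psum_part :: "nat multiset \<Rightarrow> sf" where
  "psum_part lam = sf_mprod (image_mset psum lam)"

definition is_partition :: "nat multiset \<Rightarrow> bool" where
  "is_partition lam \<longleftrightarrow> 0 \<notin># lam"

definition lincomb :: "nat multiset set \<Rightarrow> (nat multiset \<Rightarrow> rat) \<Rightarrow> sf" where
  "lincomb P c = (\<lambda>M. \<Sum>lam\<in>P. c lam * psum_part lam M)"

text \<open>The involution omega, determined by omega(p_r) = (-1)^(r-1) p_r, so
omega(p_lambda) = (-1)^(|lambda| - length lambda) p_lambda; defined on the
Q-span of the p_lambda (the ring of symmetric functions).\<close>
definition omega_sign :: "nat multiset \<Rightarrow> rat" where
  "omega_sign lam = (-1) ^ (sum_mset lam - size lam)"

definition omega :: "sf \<Rightarrow> sf" where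
  "omega f = (THE g. \<exists>P c. finite P \<and> (\<forall>lam\<in>P. is_partition lam) \<and>
       f = lincomb P c \<and> g = lincomb P (\<lambda>lam. omega_sign lam * c lam))"

definition simple_graph :: "nat set \<Rightarrow> (nat \<Rightarrow> nat \<Rightarrow> bool) \<Rightarrow> bool" where
  "simple_graph V E \<longleftrightarrow> finite V \<and> (\<forall>u v. E u v \<longrightarrow> u \<in> V \<and> v \<in> V) \<and>
      (\<forall>u v. E u v \<longrightarrow> E v u) \<and> (\<forall>v. \<not> E v v)"

definition proper_coloring :: "nat set \<Rightarrow> (nat \<Rightarrow> nat \<Rightarrow> bool) \<Rightarrow> (nat \<Rightarrow> nat) \<Rightarrow> bool" where
  "proper_coloring V E \<kappa> \<longleftrightarrow> (\<forall>u\<in>V. \<forall>v\<in>V. E u v \<longrightarrow> \<kappa> u \<noteq> \<kappa> v)"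

definition chrom_sf :: "nat set \<Rightarrow> (nat \<Rightarrow> nat \<Rightarrow> bool) \<Rightarrow> sf" where
  "chrom_sf V E M = of_nat (card {\<kappa>. \<kappa> \<in> extensional V \<and> proper_coloring V E \<kappa> \<and>
                                      image_mset \<kappa> (mset_set V) = M})"

definition near_chrom_sf :: "nat set \<Rightarrow> (nat \<Rightarrow> nat \<Rightarrow> bool) \<Rightarrow> sf" where
  "near_chrom_sf V E = (\<lambda>M. (chrom_sf V E M + omega (chrom_sf V E) M) / 2)"

text \<open>Gamma = Q[p_1, p_3, p_5, ...] = span of p_lambda with all parts odd.\<close>
definition Gamma :: "sf set" where
  "Gamma = {lincomb P c | P c. finite P \<and> (\<forall>lam\<in>P. \<forall>r\<in>#lam. odd r)}"

definition sf_alg :: "sf set \<Rightarrow> sf set" where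
  "sf_alg S = {(\<lambda>M. \<Sum>m\<in>F. c m * sf_mprod m M) | F c.
                 finite F \<and> (\<forall>m\<in>F. set_mset m \<subseteq> S)}"

definition alg_indep :: "sf set \<Rightarrow> bool" where
  "alg_indep S \<longleftrightarrow> (\<forall>F c. finite F \<and> (\<forall>m\<in>F. set_mset m \<subseteq> S) \<and>
       (\<lambda>M. \<Sum>m\<in>F. c m * sf_mprod m M) = (\<lambda>_. 0) \<longrightarrow> (\<forall>m\<in>F. c m = 0))"

definition star_V :: "nat \<Rightarrow> nat set" where "star_V n = {0..<n}"
definition star_E :: "nat \<Rightarrow> nat \<Rightarrow> nat \<Rightarrow> bool" where
  "star_E n u v \<longleftrightarrow> u < n \<and> v < n \<and> u \<noteq> v \<and> (u = 0 \<or> v = 0)"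
definition C3_V :: "nat set" where "C3_V = {0, 1, 2}"
definition C3_E :: "nat \<Rightarrow> nat \<Rightarrow> bool" where
  "C3_E u v \<longleftrightarrow> u < 3 \<and> v < 3 \<and> u \<noteq> v"

definition Y_star :: "nat \<Rightarrow> sf" where "Y_star n = near_chrom_sf (star_V n) (star_E n)"
definition Y_C3 :: sf where "Y_C3 = near_chrom_sf C3_V C3_E"

end

theory Submission
  imports Defs "HOL-Library.Poly_Mapping" "HOL-Library.Disjoint_Sets"
begin

text \<open>Write $X_G$ in power sums as the sum of $(-1)^{|S|} p_{\lambda(S)}$ over edge sets $S$, where
$\lambda(S)$ lists the sizes of the components of $(V,S)$; then $Y_G$ keeps exactly the terms with
$|\lambda| - \ell(\lambda)$ even. For a star every $\lambda(S)$ is a hook $(j+1, 1, \ldots, 1)$, so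
$Y_{S_n}$ lies in $\Gamma$, and for odd $n$ it is a nonzero multiple of $p_n$ plus products of smaller
$p_k$. Triangularity gives generation and independence.

Conversely, a generating set needs for each odd $n$ some $Y_G$ in which $p_n$ occurs, so that $G$ has $n$
vertices and is connected. The coefficient of $p_{(2,2,1,\ldots,1)}$ in $X_G$ counts pairs of disjoint
edges, and it must vanish for $Y_G$ to lie in $\Gamma$. Pairwise intersecting edges covering all
vertices form a star or a triangle. Hence every generating set contains one of the two sets, and
independence excludes anything more.\<close>

section \<open>The algebra of formal power series\<close>

text \<open>\<open>omega\<close> is a \<open>THE\<close> over all ways of writing a series as a
  combination of products of power sums. Linear independence of the p_\<lambda> makes it well
  defined, and also gives meaning to the coefficient of p_n in Y_G. The computations therefore take
  place among formal polynomials in the p_r, which map to series by a ring homomorphism that is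
  injective as long as all parts are positive. Two gradings share the work. The number of power sum
  factors yields independence, and shows that p_n never arises from a product of two or more
  generators without constant term. The degree drives the recursion that solves for p_n in terms of
  the generators. The one Y_G with a constant term is Y = 1 of the empty graph; algebraic
  independence keeps it out of the set. The type (2,2,1,...,1) is a usable obstruction for two
  reasons: |\<lambda>| minus the length is 2, so the term survives in Y_G, and every edge set of
  this type has exactly two edges, so no signs cancel.\<close>

lemma finite_subset_mset: "finite {N. N \<subseteq># M}"
proof (induction M)
  case (add x M)
  have "{N. N \<subseteq># add_mset x M} \<subseteq> {N. N \<subseteq># M} \<union> add_mset x ` {N. N \<subseteq># M}"
  proof
    fix N assume N: "N \<in> {N. N \<subseteq># add_mset x M}"
    show "N \<in> {N. N \<subseteq># M} \<union> add_mset x ` {N. N \<subseteq># M}"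
    proof (cases "x \<in># N")
      case True
      then obtain K where "N = add_mset x K" by (metis insert_DiffM)
      with N show ?thesis by auto
    next
      case False
      have "count N y \<le> count M y" for y
        using N False mset_subset_eq_count[of N "add_mset x M" y]
        by (cases "y = x") (auto simp: not_in_iff)
      then show ?thesis by (simp add: subseteq_mset_def)
    qed
  qed
  with add.IH show ?case by (meson finite_UnI finite_imageI finite_subset)
qed simp

lemma sf_mult_sf_one: "sf_mult sf_one f = f"
proof
  fix M
  have "sf_mult sf_one f M = (\<Sum>N\<in>{N. N \<subseteq># M}. if N = {#} then f M else 0)"
    unfolding sf_mult_def sf_one_def by (intro sum.cong) auto
  then show "sf_mult sf_one f M = f M" by (simp add: finite_subset_mset)
qed

text \<open>Both sides are sums over pairs of submultisets whose sum lies below \<open>M\<close>,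
  and swapping the pair exchanges them. This form is what \<open>fold_mset\<close> needs for
  \<open>sf_mprod\<close> to be independent of the order of factors.\<close>

lemma sf_mult_left_commute: "sf_mult f (sf_mult g h) = sf_mult g (sf_mult f h)"
proof
  fix M
  have expand: "sf_mult f (sf_mult g h) M =
      (\<Sum>(N, K)\<in>{(N, K). N + K \<subseteq># M}. f N * g K * h (M - N - K))" for f g
  proof -
    have "sf_mult f (sf_mult g h) M =
        (\<Sum>N\<in>{N. N \<subseteq># M}. \<Sum>K\<in>{K. K \<subseteq># M - N}. f N * g K * h (M - N - K))"
      by (simp add: sf_mult_def sum_distrib_left mult.assoc)
    also have "\<dots> = (\<Sum>(N, K)\<in>(SIGMA N:{N. N \<subseteq># M}. {K. K \<subseteq># M - N}). f N * g K * h (M - N - K))"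
      by (rule sum.Sigma) (auto simp: finite_subset_mset)
    also have "(SIGMA N:{N. N \<subseteq># M}. {K. K \<subseteq># M - N}) = {(N, K). N + K \<subseteq># M}"
      proof (intro set_eqI iffI; clarsimp)
      fix N K
      { assume "N \<subseteq># M" "K \<subseteq># M - N"
        then show "N + K \<subseteq># M" by (simp add: subset_mset.le_diff_conv2 add.commute) }
      assume *: "N + K \<subseteq># M"
      then have "N \<subseteq># M" by (meson mset_subset_eq_add_left subset_mset.order_trans)
      with * show "N \<subseteq># M \<and> K \<subseteq># M - N" by (simp add: subset_mset.le_diff_conv2 add.commute)
    qed
    finally show ?thesis .
  qed
  show "sf_mult f (sf_mult g h) M = sf_mult g (sf_mult f h) M"
    unfolding expand
    by (rule sum.reindex_bij_witness[of _ prod.swap prod.swap])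
       (auto simp: add.commute mult_ac diff_diff_add_mset)
qed

lemma double_diff_mset: "N \<subseteq># M \<Longrightarrow> M - (M - N) = N"
  by (metis add_diff_cancel_left' subset_mset.add_diff_inverse subset_mset.diff_add)

lemma sf_mult_commute: "sf_mult f g = sf_mult g f"
proof
  fix M
  show "sf_mult f g M = sf_mult g f M"
    unfolding sf_mult_def
    by (rule sum.reindex_bij_witness[of _ "\<lambda>N. M - N" "\<lambda>N. M - N"])
       (auto simp: double_diff_mset mult.commute)
qed

lemma sf_mult_sf_one_right: "sf_mult f sf_one = f"
  by (metis sf_mult_commute sf_mult_sf_one)

lemma sf_mult_assoc: "sf_mult (sf_mult f g) h = sf_mult f (sf_mult g h)"
  by (metis sf_mult_commute sf_mult_left_commute)

lemma sf_mult_add_left: "sf_mult (\<lambda>M. f M + g M) h = (\<lambda>M. sf_mult f h M + sf_mult g h M)"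
  by (simp add: sf_mult_def fun_eq_iff distrib_right sum.distrib)

lemma sf_mult_add_right: "sf_mult h (\<lambda>M. f M + g M) = (\<lambda>M. sf_mult h f M + sf_mult h g M)"
  by (simp add: sf_mult_def fun_eq_iff distrib_left sum.distrib)

lemma sf_mult_scale: "sf_mult (\<lambda>M. a * f M) (\<lambda>M. b * g M) = (\<lambda>M. a * b * sf_mult f g M)"
  by (simp add: sf_mult_def fun_eq_iff sum_distrib_left mult_ac)

lemma sf_mult_zero_left: "sf_mult (\<lambda>M. 0) f = (\<lambda>M. 0)"
  by (simp add: sf_mult_def fun_eq_iff)

lemma sf_mult_zero_right: "sf_mult f (\<lambda>M. 0) = (\<lambda>M. 0)"
  by (simp add: sf_mult_def fun_eq_iff)

interpretation sf_mult: comp_fun_commute sf_mult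
  by unfold_locales (simp add: fun_eq_iff sf_mult_left_commute)

lemma sf_mprod_empty [simp]: "sf_mprod {#} = sf_one"
  by (simp add: sf_mprod_def)

lemma sf_mprod_add_mset [simp]: "sf_mprod (add_mset f m) = sf_mult f (sf_mprod m)"
  by (simp add: sf_mprod_def)

lemma sf_mprod_union: "sf_mprod (m + n) = sf_mult (sf_mprod m) (sf_mprod n)"
  by (induction m) (simp_all add: sf_mult_sf_one sf_mult_assoc)

lemma psum_part_empty [simp]: "psum_part {#} = sf_one"
  by (simp add: psum_part_def)

lemma psum_part_add_mset [simp]: "psum_part (add_mset r lam) = sf_mult (psum r) (psum_part lam)"
  by (simp add: psum_part_def)

lemma psum_part_union: "psum_part (lam + mu) = sf_mult (psum_part lam) (psum_part mu)"
  by (simp add: psum_part_def sf_mprod_union)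

section \<open>Polynomials in the power sums\<close>

text \<open>Multisets form a commutative monoid under \<open>+\<close>, so the product of
  \<open>Poly_Mapping\<close> is that of polynomials: the key \<open>lam\<close> stands for the
  monomial p_\<lambda>, and \<open>{#}\<close> for the constant monomial.\<close>

type_synonym ppoly = "nat multiset \<Rightarrow>\<^sub>0 rat"

abbreviation coeff :: "ppoly \<Rightarrow> nat multiset \<Rightarrow> rat" where
  "coeff \<equiv> Poly_Mapping.lookup"

definition psum_eval :: "ppoly \<Rightarrow> sf" where
  "psum_eval q = lincomb (Poly_Mapping.keys q) (coeff q)"

lemma psum_eval_superset:
  assumes "finite P" "Poly_Mapping.keys q \<subseteq> P"
  shows "psum_eval q = lincomb P (coeff q)"
  unfolding psum_eval_def lincomb_def
  by (intro ext sum.mono_neutral_left assms) (auto simp: in_keys_iff)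

lemma psum_eval_zero [simp]: "psum_eval 0 = (\<lambda>M. 0)"
  by (simp add: psum_eval_def lincomb_def)

lemma psum_eval_single [simp]: "psum_eval (Poly_Mapping.single lam a) = (\<lambda>M. a * psum_part lam M)"
  by (simp add: psum_eval_def lincomb_def)

lemma psum_eval_one [simp]: "psum_eval 1 = sf_one"
  by (simp add: single_one[symmetric] del: single_one)

lemma psum_eval_add: "psum_eval (q + r) = (\<lambda>M. psum_eval q M + psum_eval r M)"
proof -
  let ?P = "Poly_Mapping.keys q \<union> Poly_Mapping.keys r"
  have "psum_eval (q + r) = lincomb ?P (coeff (q + r))"
    by (rule psum_eval_superset) (use keys_add[of q r] in auto)
  moreover have "psum_eval q = lincomb ?P (coeff q)" "psum_eval r = lincomb ?P (coeff r)"
    by (rule psum_eval_superset; simp)+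
  ultimately show ?thesis
    by (simp add: lincomb_def lookup_add distrib_right sum.distrib)
qed

lemma psum_eval_sum: "psum_eval (sum f I) = (\<lambda>M. \<Sum>i\<in>I. psum_eval (f i) M)"
  by (induction I rule: infinite_finite_induct) (simp_all add: psum_eval_add)

lemma ppoly_eq_sum_single:
  assumes "finite P" "Poly_Mapping.keys q \<subseteq> P"
  shows "q = (\<Sum>lam\<in>P. Poly_Mapping.single lam (coeff q lam))"
proof (rule poly_mapping_eqI)
  fix k
  have "coeff (\<Sum>lam\<in>P. Poly_Mapping.single lam (coeff q lam)) k =
      (\<Sum>lam\<in>P. if k = lam then coeff q k else 0)"
    unfolding lookup_sum by (intro sum.cong) (auto simp: lookup_single when_def)
  also have "\<dots> = coeff q k" using assms by (auto simp: in_keys_iff)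
  finally show "coeff q k = coeff (\<Sum>lam\<in>P. Poly_Mapping.single lam (coeff q lam)) k" by simp
qed

lemma ppoly_induct [case_names zero single add]:
  fixes q :: ppoly
  assumes "P 0" "\<And>lam a. P (Poly_Mapping.single lam a)" "\<And>q r. P q \<Longrightarrow> P r \<Longrightarrow> P (q + r)"
  shows "P q"
proof -
  have "P (\<Sum>lam\<in>I. Poly_Mapping.single lam (coeff q lam))" if "finite I" for I
    using that by induction (auto intro: assms)
  then show ?thesis using ppoly_eq_sum_single[of "Poly_Mapping.keys q" q] by (metis finite_keys order_refl)
qed

lemma psum_eval_mult: "psum_eval (q * r) = sf_mult (psum_eval q) (psum_eval r)"
proof (induction q rule: ppoly_induct)
  case (single lam a)
  show ?case
  proof (induction r rule: ppoly_induct)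
    case (single mu b)
    show ?case by (simp add: mult_single sf_mult_scale psum_part_union)
  qed (simp_all add: distrib_left psum_eval_add sf_mult_add_right sf_mult_zero_right)
qed (simp_all add: distrib_right psum_eval_add sf_mult_add_left sf_mult_zero_left)

lemma psum_eval_prod_mset:
  "psum_eval (\<Prod>x\<in>#m. f x) = sf_mprod (image_mset (\<lambda>x. psum_eval (f x)) m)"
  by (induction m) (simp_all add: psum_eval_mult)

lemma lincomb_eq_psum_eval:
  "lincomb P c = psum_eval (\<Sum>lam\<in>P. Poly_Mapping.single lam (c lam))"
  by (simp add: psum_eval_sum lincomb_def)

text \<open>Linear independence of the $p_\lambda$: the coefficient of $p_\mu$ at a monomial with exponents
$\lambda$ vanishes unless $\mu$ refines $\lambda$, so among the $\lambda$ of maximal length in a relation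
only $\lambda$ itself contributes there.\<close>

definition mult_type :: "nat multiset \<Rightarrow> nat multiset" where
  "mult_type M = image_mset (count M) (mset_set (set_mset M))"

lemma psum_nonneg: "psum r M \<ge> 0"
  by (simp add: psum_def)

lemma psum_part_nonneg: "psum_part lam M \<ge> 0"
  by (induction lam arbitrary: M) (auto simp: sf_one_def sf_mult_def intro!: sum_nonneg mult_nonneg_nonneg psum_nonneg)

lemma psum_part_add_mset_nonzero:
  assumes "psum_part (add_mset r lam) M \<noteq> 0"
  obtains i where "0 < r" "replicate_mset r i \<subseteq># M" "psum_part lam (M - replicate_mset r i) \<noteq> 0"
proof -
  from assms obtain N where "N \<in> {N. N \<subseteq># M}" "psum r N * psum_part lam (M - N) \<noteq> 0"
    unfolding psum_part_add_mset sf_mult_def by (rule sum.not_neutral_contains_not_neutral)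
  then show ?thesis using that by (auto simp: psum_def split: if_splits)
qed

lemma mult_type_add_replicate:
  assumes "0 < r" "i \<notin># N"
  shows "mult_type (replicate_mset r i + N) = add_mset r (mult_type N)"
proof -
  have "set_mset (replicate_mset r i + N) = insert i (set_mset N)" using assms by auto
  moreover have "image_mset (count (replicate_mset r i + N)) (mset_set (set_mset N)) = mult_type N"
    unfolding mult_type_def by (intro image_mset_cong) (use assms in auto)
  ultimately show ?thesis using assms by (simp add: mult_type_def not_in_iff)
qed

text \<open>A monomial of p_\<lambda> arises by choosing one variable for each part. It has as many
  distinct variables as there are parts only if all choices differ, and then its exponents are the
  parts themselves.\<close>

lemma psum_part_nonzero_imp:
  assumes "psum_part lam M \<noteq> 0"
  shows "card (set_mset M) \<le> size lam \<and> (card (set_mset M) = size lam \<longrightarrow> mult_type M = lam)"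
  using assms
proof (induction lam arbitrary: M)
  case empty
  then show ?case by (auto simp: sf_one_def mult_type_def split: if_splits)
next
  case (add r lam)
  obtain i where i: "0 < r" "replicate_mset r i \<subseteq># M" "psum_part lam (M - replicate_mset r i) \<noteq> 0"
    using psum_part_add_mset_nonzero[OF add.prems] .
  define N where "N = M - replicate_mset r i"
  have M: "M = replicate_mset r i + N" using i(2) by (simp add: N_def)
  note IH = add.IH[OF i(3), folded N_def]
  have set_M: "set_mset M = insert i (set_mset N)" using i(1) by (auto simp: M)
  show ?case
  proof (cases "i \<in># N")
    case True
    then have "set_mset M = set_mset N" using set_M by auto
    then show ?thesis using IH by simp
  next
    case False
    then show ?thesis using IH mult_type_add_replicate[OF i(1) False] by (auto simp: set_M M)
  qed
qed

text \<open>Each part gets a fresh variable. All coefficients are nonnegative, so the one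
  contribution exhibited cannot be cancelled by others.\<close>

lemma exists_mult_type:
  assumes "is_partition lam"
  shows "\<exists>M. mult_type M = lam \<and> card (set_mset M) = size lam \<and> psum_part lam M \<noteq> 0"
  using assms
proof (induction lam)
  case empty
  show ?case by (rule exI[of _ "{#}"]) (simp add: mult_type_def sf_one_def)
next
  case (add r lam)
  then obtain N where N: "mult_type N = lam" "card (set_mset N) = size lam" "psum_part lam N \<noteq> 0" and r: "0 < r"
    by (auto simp: is_partition_def intro: gr0I)
  obtain i where i: "i \<notin># N" using ex_new_if_finite[of "set_mset N"] by auto
  define M where "M = replicate_mset r i + N"
  have "0 < psum r (replicate_mset r i) * psum_part lam (M - replicate_mset r i)"
    using N(3) r psum_part_nonneg[of lam N] by (auto simp: psum_def M_def)
  also have "\<dots> \<le> psum_part (add_mset r lam) M"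
    unfolding psum_part_add_mset sf_mult_def
    by (rule member_le_sum)
       (auto simp: finite_subset_mset M_def intro!: mult_nonneg_nonneg psum_nonneg psum_part_nonneg)
  finally have "psum_part (add_mset r lam) M \<noteq> 0" by simp
  moreover have "set_mset M = insert i (set_mset N)" using r by (auto simp: M_def)
  ultimately show ?case
    using mult_type_add_replicate[OF r i] N i by (intro exI[of _ M]) (auto simp: M_def)
qed

text \<open>Two choices of \<open>R\<close> matter. Positive parts are where
  \<open>psum_eval\<close> is injective, since \<open>psum 0\<close> is the zero series; odd parts
  describe \<open>Gamma\<close>.\<close>

definition parts_in :: "nat set \<Rightarrow> ppoly \<Rightarrow> bool" where
  "parts_in R q \<longleftrightarrow> (\<forall>lam\<in>Poly_Mapping.keys q. set_mset lam \<subseteq> R)"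

lemma is_partition_iff: "is_partition lam \<longleftrightarrow> set_mset lam \<subseteq> {0<..}"
  by (auto simp: is_partition_def intro: gr0I)

lemma parts_in_zero [simp]: "parts_in R 0"
  by (simp add: parts_in_def)

lemma parts_in_one [simp]: "parts_in R 1"
  by (simp add: parts_in_def)

lemma parts_in_single: "set_mset lam \<subseteq> R \<Longrightarrow> parts_in R (Poly_Mapping.single lam a)"
  by (simp add: parts_in_def)

lemma parts_in_add: "parts_in R q \<Longrightarrow> parts_in R r \<Longrightarrow> parts_in R (q + r)"
  using keys_add[of q r] by (auto simp: parts_in_def)

lemma parts_in_diff: "parts_in R q \<Longrightarrow> parts_in R r \<Longrightarrow> parts_in R (q - r)"
  using keys_diff[of q r] by (fastforce simp: parts_in_def)

lemma parts_in_mult: "parts_in R q \<Longrightarrow> parts_in R r \<Longrightarrow> parts_in R (q * r)"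
  using keys_mult[of q r] by (fastforce simp: parts_in_def)

lemma parts_in_sum: "(\<And>i. i \<in> I \<Longrightarrow> parts_in R (f i)) \<Longrightarrow> parts_in R (sum f I)"
  by (induction I rule: infinite_finite_induct) (auto intro: parts_in_add)

lemma parts_in_prod_mset: "(\<And>x. x \<in># m \<Longrightarrow> parts_in R (f x)) \<Longrightarrow> parts_in R (\<Prod>x\<in>#m. f x)"
  by (induction m) (auto intro: parts_in_mult)

lemma parts_in_mono: "parts_in R q \<Longrightarrow> R \<subseteq> R' \<Longrightarrow> parts_in R' q"
  by (auto simp: parts_in_def)

lemma psum_eval_eq_0:
  assumes "parts_in {0<..} q" "psum_eval q = (\<lambda>M. 0)"
  shows "q = 0"
proof (rule ccontr)
  assume "q \<noteq> 0"
  then have "Poly_Mapping.keys q \<noteq> {}" by (auto simp: poly_mapping_eq_iff fun_eq_iff in_keys_iff)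
  then have "Max (size ` Poly_Mapping.keys q) \<in> size ` Poly_Mapping.keys q" by (intro Max_in) auto
  then obtain lam where lam: "lam \<in> Poly_Mapping.keys q" "size lam = Max (size ` Poly_Mapping.keys q)"
    by auto
  then have max: "size mu \<le> size lam" if "mu \<in> Poly_Mapping.keys q" for mu
    using that by simp
  obtain M where M: "mult_type M = lam" "card (set_mset M) = size lam" "psum_part lam M \<noteq> 0"
    using exists_mult_type lam assms(1) unfolding parts_in_def is_partition_iff by blast
  have "psum_part mu M = 0" if "mu \<in> Poly_Mapping.keys q" "mu \<noteq> lam" for mu
    using psum_part_nonzero_imp[of mu M] max[OF that(1)] M that(2) by auto
  then have "psum_eval q M = (\<Sum>mu\<in>Poly_Mapping.keys q. if mu = lam then coeff q lam * psum_part lam M else 0)"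
    unfolding psum_eval_def lincomb_def by (intro sum.cong) auto
  also have "\<dots> = coeff q lam * psum_part lam M" using lam by simp
  finally show False using assms(2) M(3) lam by (simp add: in_keys_iff)
qed

lemma psum_eval_inj:
  assumes "parts_in {0<..} q" "parts_in {0<..} r" "psum_eval q = psum_eval r"
  shows "q = r"
proof -
  have "psum_eval q = (\<lambda>M. psum_eval (q - r) M + psum_eval r M)"
    by (simp add: psum_eval_add[symmetric])
  with assms(3) have "psum_eval (q - r) = (\<lambda>M. 0)"
    by (simp add: fun_eq_iff)
  then have "q - r = 0" using assms by (intro psum_eval_eq_0 parts_in_diff)
  then show ?thesis by simp
qed

lemma coeff_scale: "coeff (Poly_Mapping.single {#} c * q) k = c * coeff q k"
proof -
  have "coeff (Poly_Mapping.map ((*) c) q) k = c * coeff q k"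
    by (simp add: Poly_Mapping.map.rep_eq when_def)
  then show ?thesis by (simp add: mult_map_scale_conv_mult)
qed

lemma Gamma_eq: "Gamma = psum_eval ` {q. parts_in {r. odd r} q}"
proof
  show "Gamma \<subseteq> psum_eval ` {q. parts_in {r. odd r} q}"
    by (auto simp: Gamma_def lincomb_eq_psum_eval intro!: imageI parts_in_sum parts_in_single)
  show "psum_eval ` {q. parts_in {r. odd r} q} \<subseteq> Gamma"
    unfolding Gamma_def psum_eval_def parts_in_def
    by (auto intro!: exI[of _ "Poly_Mapping.keys _"])
qed

text \<open>Lifts an element of a generated algebra to a formal polynomial, by replacing every
  generator with a preimage under \<open>psum_eval\<close>. The map \<open>h\<close> translates
  multisets of generators into multisets of whatever indexes the preimages.\<close>

lemma psum_eval_combination: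
  "psum_eval (\<Sum>m\<in>F. Poly_Mapping.single {#} (c m) * (\<Prod>x\<in>#h m. g x)) =
    (\<lambda>M. \<Sum>m\<in>F. c m * sf_mprod (image_mset (\<lambda>x. psum_eval (g x)) (h m)) M)"
proof -
  have "psum_eval (Poly_Mapping.single {#} a * q) = (\<lambda>M. a * psum_eval q M)" for a q
    using sf_mult_scale[of a sf_one 1 "psum_eval q"] by (simp add: psum_eval_mult sf_mult_sf_one)
  then show ?thesis by (simp add: psum_eval_sum psum_eval_prod_mset)
qed

section \<open>Generated subalgebras and algebraic independence\<close>

lemma sf_algE:
  assumes "f \<in> sf_alg S"
  obtains F c where "finite F" "\<forall>m\<in>F. set_mset m \<subseteq> S" "f = (\<lambda>M. \<Sum>m\<in>F. c m * sf_mprod m M)"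
proof -
  from assms have "\<exists>F c. f = (\<lambda>M. \<Sum>m\<in>F. c m * sf_mprod m M) \<and> finite F \<and> (\<forall>m\<in>F. set_mset m \<subseteq> S)"
    unfolding sf_alg_def by (rule CollectD)
  then show ?thesis using that by fast
qed

lemma sf_alg_zero: "(\<lambda>M. 0) \<in> sf_alg S"
  unfolding sf_alg_def by (auto intro!: exI[of _ "{}"])

lemma sf_alg_one: "sf_one \<in> sf_alg S"
  unfolding sf_alg_def by (auto intro!: exI[of _ "{{#}}"] exI[of _ "\<lambda>_. 1"])

lemma sf_alg_superset: "S \<subseteq> sf_alg S"
proof
  fix s assume "s \<in> S"
  then show "s \<in> sf_alg S"
    unfolding sf_alg_def
    by (auto intro!: exI[of _ "{{#s#}}"] exI[of _ "\<lambda>_. 1"] simp: sf_mult_sf_one_right)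
qed

lemma sf_alg_scale:
  assumes "f \<in> sf_alg S"
  shows "(\<lambda>M. a * f M) \<in> sf_alg S"
proof -
  obtain F c where "finite F" "\<forall>m\<in>F. set_mset m \<subseteq> S" "f = (\<lambda>M. \<Sum>m\<in>F. c m * sf_mprod m M)"
    using sf_algE[OF assms] .
  then show ?thesis
    unfolding sf_alg_def
    by (auto intro!: exI[of _ F] exI[of _ "\<lambda>m. a * c m"] simp: sum_distrib_left mult.assoc)
qed

lemma sf_alg_add:
  assumes "f \<in> sf_alg S" "g \<in> sf_alg S"
  shows "(\<lambda>M. f M + g M) \<in> sf_alg S"
proof -
  obtain F c where F: "finite F" "\<forall>m\<in>F. set_mset m \<subseteq> S" "f = (\<lambda>M. \<Sum>m\<in>F. c m * sf_mprod m M)"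
    using sf_algE[OF assms(1)] .
  obtain G d where G: "finite G" "\<forall>m\<in>G. set_mset m \<subseteq> S" "g = (\<lambda>M. \<Sum>m\<in>G. d m * sf_mprod m M)"
    using sf_algE[OF assms(2)] .
  define e where "e m = (if m \<in> F then c m else 0) + (if m \<in> G then d m else 0)" for m
  have "f M + g M = (\<Sum>m\<in>F \<union> G. e m * sf_mprod m M)" for M
  proof -
    have "f M = (\<Sum>m\<in>F \<union> G. (if m \<in> F then c m else 0) * sf_mprod m M)"
      unfolding F(3) by (intro sum.mono_neutral_cong_left) (use F G in auto)
    moreover have "g M = (\<Sum>m\<in>F \<union> G. (if m \<in> G then d m else 0) * sf_mprod m M)"
      unfolding G(3) by (intro sum.mono_neutral_cong_left) (use F G in auto)
    ultimately show ?thesis by (simp add: e_def distrib_right sum.distrib)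
  qed
  with F G show ?thesis
    unfolding sf_alg_def by (auto intro!: exI[of _ "F \<union> G"] exI[of _ e])
qed

lemma sf_alg_sum:
  "(\<And>i. i \<in> I \<Longrightarrow> f i \<in> sf_alg S) \<Longrightarrow> (\<lambda>M. \<Sum>i\<in>I. f i M) \<in> sf_alg S"
  by (induction I rule: infinite_finite_induct) (auto intro: sf_alg_zero sf_alg_add)

lemma sf_mult_sum_left: "sf_mult (\<lambda>M. \<Sum>i\<in>I. f i M) g = (\<lambda>M. \<Sum>i\<in>I. sf_mult (f i) g M)"
  by (induction I rule: infinite_finite_induct) (simp_all add: sf_mult_add_left sf_mult_zero_left)

lemma sf_alg_mult_generator:
  assumes "s \<in> S" "f \<in> sf_alg S"
  shows "sf_mult s f \<in> sf_alg S"
proof -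
  obtain F c where F: "finite F" "\<forall>m\<in>F. set_mset m \<subseteq> S" "f = (\<lambda>M. \<Sum>m\<in>F. c m * sf_mprod m M)"
    using sf_algE[OF assms(2)] .
  have "sf_mult s (\<lambda>M. c m * sf_mprod m M) \<in> sf_alg S" if "m \<in> F" for m
  proof -
    have "sf_mult s (\<lambda>M. c m * sf_mprod m M) = (\<lambda>M. c m * sf_mprod (add_mset s m) M)"
      using sf_mult_scale[of 1 s "c m" "sf_mprod m"] by simp
    moreover have "set_mset (add_mset s m) \<subseteq> S" using that F(2) assms(1) by auto
    ultimately show ?thesis
      unfolding sf_alg_def by (intro CollectI exI[of _ "{add_mset s m}"] exI[of _ "\<lambda>_. c m"]) simp
  qed
  then have "(\<lambda>M. \<Sum>m\<in>F. sf_mult (\<lambda>M. c m * sf_mprod m M) s M) \<in> sf_alg S"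
    by (intro sf_alg_sum) (simp add: sf_mult_commute[of s])
  then show ?thesis
    unfolding F(3) by (subst sf_mult_commute) (simp add: sf_mult_sum_left)
qed

lemma sf_alg_mult:
  assumes "f \<in> sf_alg S" "g \<in> sf_alg S"
  shows "sf_mult f g \<in> sf_alg S"
proof -
  obtain F c where F: "finite F" "\<forall>m\<in>F. set_mset m \<subseteq> S" "f = (\<lambda>M. \<Sum>m\<in>F. c m * sf_mprod m M)"
    using sf_algE[OF assms(1)] .
  have prod: "set_mset m \<subseteq> S \<Longrightarrow> sf_mult (sf_mprod m) g \<in> sf_alg S" for m
    by (induction m) (auto simp: sf_mult_sf_one sf_mult_assoc assms intro: sf_alg_mult_generator)
  have "sf_mult (\<lambda>M. c m * sf_mprod m M) g \<in> sf_alg S" if "m \<in> F" for m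
    using sf_alg_scale[OF prod, of m "c m"] sf_mult_scale[of "c m" "sf_mprod m" 1 g] that F(2) by simp
  then have "(\<lambda>M. \<Sum>m\<in>F. sf_mult (\<lambda>M. c m * sf_mprod m M) g M) \<in> sf_alg S"
    by (intro sf_alg_sum)
  then show ?thesis unfolding F(3) by (simp add: sf_mult_sum_left)
qed

text \<open>The empty product and the generator \<open>sf_one\<close> are distinct monomials with
  the same value, so their difference is a nontrivial relation. This is what excludes the empty
  graph.\<close>

lemma sf_one_notin_alg_indep:
  assumes "alg_indep S"
  shows "sf_one \<notin> S"
proof
  assume "sf_one \<in> S"
  define c where "c m = (if m = {#} then 1 else - 1 :: rat)" for m :: "sf multiset"
  have "(\<lambda>M. \<Sum>m\<in>{{#}, {#sf_one#}}. c m * sf_mprod m M) = (\<lambda>_. 0)"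
    by (simp add: c_def sf_mult_sf_one)
  moreover have "finite {{#}, {#sf_one#}}" "\<forall>m\<in>{{#}, {#sf_one#}}. set_mset m \<subseteq> S"
    using \<open>sf_one \<in> S\<close> by auto
  ultimately have "c {#} = 0"
    using assms unfolding alg_indep_def by blast
  then show False by (simp add: c_def)
qed

text \<open>An element \<open>s\<close> outside \<open>A\<close> equals a polynomial in elements of
  \<open>A\<close>. That polynomial minus \<open>s\<close> is a relation in which the monomial
  \<open>{#s#}\<close> has coefficient -1.\<close>

lemma alg_indep_generated_eq:
  assumes "alg_indep S" "A \<subseteq> S" "S \<subseteq> sf_alg A"
  shows "S = A"
proof (rule ccontr)
  assume "S \<noteq> A"
  then obtain s where s: "s \<in> S" "s \<notin> A" using assms(2) by auto
  obtain F c where F: "finite F" "\<forall>m\<in>F. set_mset m \<subseteq> A" "s = (\<lambda>M. \<Sum>m\<in>F. c m * sf_mprod m M)"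
    using sf_algE[OF subsetD[OF assms(3) s(1)]] .
  have notin: "{#s#} \<notin> F" using F(2) s by auto
  define d where "d = c({#s#} := - 1)"
  have sum_F: "(\<Sum>m\<in>F. d m * sf_mprod m M) = s M" for M
    unfolding F(3) by (intro sum.cong) (use notin in \<open>auto simp: d_def\<close>)
  have "(\<lambda>M. \<Sum>m\<in>insert {#s#} F. d m * sf_mprod m M) = (\<lambda>_. 0)"
  proof
    fix M
    show "(\<Sum>m\<in>insert {#s#} F. d m * sf_mprod m M) = 0"
      using F(1) notin sum_F[of M] by (simp add: d_def sf_mult_sf_one_right)
  qed
  moreover have "finite (insert {#s#} F)" "\<forall>m\<in>insert {#s#} F. set_mset m \<subseteq> S"
    using F s assms(2) by auto
  ultimately have "d {#s#} = 0"
    using assms(1) unfolding alg_indep_def by blast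
  then show False by (simp add: d_def)
qed

text \<open>The order is the number of power sum factors, not the degree in the $x_i$.\<close>

definition order_ge :: "nat \<Rightarrow> ppoly \<Rightarrow> bool" where
  "order_ge k q \<longleftrightarrow> (\<forall>lam\<in>Poly_Mapping.keys q. k \<le> size lam)"

lemma order_ge_coeff: "order_ge k q \<Longrightarrow> size lam < k \<Longrightarrow> coeff q lam = 0"
  by (auto simp: order_ge_def in_keys_iff dest: leD)

lemma order_ge_mono: "order_ge k q \<Longrightarrow> l \<le> k \<Longrightarrow> order_ge l q"
  by (auto simp: order_ge_def)

lemma order_ge_add: "order_ge k q \<Longrightarrow> order_ge k r \<Longrightarrow> order_ge k (q + r)"
  using keys_add[of q r] by (auto simp: order_ge_def)

lemma order_ge_mult: "order_ge k q \<Longrightarrow> order_ge l r \<Longrightarrow> order_ge (k + l) (q * r)"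
  using keys_mult[of q r] by (fastforce simp: order_ge_def intro: add_mono)

lemma order_ge_single: "k \<le> size lam \<Longrightarrow> order_ge k (Poly_Mapping.single lam a)"
  by (simp add: order_ge_def)

lemma order_ge_prod_mset:
  "(\<And>x. x \<in># m \<Longrightarrow> order_ge 1 (f x)) \<Longrightarrow> order_ge (size m) (\<Prod>x\<in>#m. f x)"
proof (induction m)
  case (add x m)
  then show ?case using order_ge_mult[of 1 "f x" "size m"] by simp
qed (simp add: order_ge_def)

text \<open>Modulo terms with more factors, a product of generators is the product of their linear
  terms, hence a single monomial that records which generators were multiplied.\<close>

lemma order_ge_prod_mset_leading:
  assumes "\<And>n. n \<in># m \<Longrightarrow> order_ge 2 (g n - Poly_Mapping.single {#n#} (a n))"
  shows "order_ge (Suc (size m)) ((\<Prod>n\<in>#m. g n) - Poly_Mapping.single m (\<Prod>n\<in>#m. a n))"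
  using assms
proof (induction m)
  case (add x m)
  let ?x = "Poly_Mapping.single {#x#} (a x)" and ?P = "\<Prod>n\<in>#m. g n"
    and ?M = "Poly_Mapping.single m (\<Prod>n\<in>#m. a n)"
  have eq: "(\<Prod>n\<in>#add_mset x m. g n) - Poly_Mapping.single (add_mset x m) (\<Prod>n\<in>#add_mset x m. a n)
      = (g x - ?x) * ?P + ?x * (?P - ?M)"
    by (simp add: algebra_simps mult_single)
  have "order_ge 1 (g n)" if "n \<in># m" for n
    using order_ge_add[OF order_ge_mono[OF add.prems] order_ge_single, of n 1 "{#n#}" "a n"] that by simp
  then have "order_ge (size m) ?P" by (rule order_ge_prod_mset)
  then have "order_ge (2 + size m) ((g x - ?x) * ?P)" using add.prems by (intro order_ge_mult) auto
  moreover have "order_ge (1 + Suc (size m)) (?x * (?P - ?M))"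
    by (intro order_ge_mult order_ge_single) (use add in auto)
  ultimately show ?case unfolding eq by (intro order_ge_add) simp_all
qed (simp add: order_ge_def)

text \<open>Distinct products of generators have distinct leading monomials, so the shortest terms
  of a relation cannot cancel.\<close>

lemma alg_indep_of_leading_terms:
  assumes pos: "\<And>n. n \<in> I \<Longrightarrow> parts_in {0<..} (g n)"
    and nz: "\<And>n. n \<in> I \<Longrightarrow> a n \<noteq> 0"
    and lead: "\<And>n. n \<in> I \<Longrightarrow> order_ge 2 (g n - Poly_Mapping.single {#n#} (a n))"
  shows "alg_indep ((\<lambda>n. psum_eval (g n)) ` I)"
  unfolding alg_indep_def
proof (intro allI impI)
  let ?h = "\<lambda>n. psum_eval (g n)"
  fix F c
  assume "finite F \<and> (\<forall>m\<in>F. set_mset m \<subseteq> ?h ` I) \<and> (\<lambda>M. \<Sum>m\<in>F. c m * sf_mprod m M) = (\<lambda>_. 0)"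
  then have F: "finite F" "\<And>m. m \<in> F \<Longrightarrow> set_mset m \<subseteq> ?h ` I"
    and rel: "(\<lambda>M. \<Sum>m\<in>F. c m * sf_mprod m M) = (\<lambda>_. 0)" by auto
  \<comment> \<open>Replaces each generator by one chosen index. Applying
    \<open>image_mset ?h\<close> undoes this, so \<open>mu\<close> is injective on \<open>F\<close>
    even if several indices give the same generator.\<close>
  define mu where "mu m = image_mset (inv_into I ?h) m" for m
  have mu: "image_mset ?h (mu m) = m" "set_mset (mu m) \<subseteq> I" if "m \<in> F" for m
  proof -
    have "image_mset ?h (mu m) = image_mset id m"
      unfolding mu_def multiset.map_comp
      by (intro image_mset_cong) (use F(2)[OF that] in \<open>auto intro!: f_inv_into_f[of _ ?h I]\<close>)
    then show "image_mset ?h (mu m) = m" by simp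
    show "set_mset (mu m) \<subseteq> I"
      using F(2)[OF that] by (auto simp: mu_def intro!: inv_into_into)
  qed
  define q where "q = (\<Sum>m\<in>F. Poly_Mapping.single {#} (c m) * (\<Prod>n\<in>#mu m. g n))"
  have "psum_eval q = (\<lambda>M. \<Sum>m\<in>F. c m * sf_mprod m M)"
    unfolding q_def psum_eval_combination by (intro ext sum.cong) (auto simp: mu)
  moreover have "parts_in {0<..} q"
    unfolding q_def by (intro parts_in_sum parts_in_mult parts_in_prod_mset parts_in_single pos) (use mu in auto)
  ultimately have "q = 0" using rel by (intro psum_eval_eq_0) simp_all
  show "\<forall>m\<in>F. c m = 0"
  proof (rule ccontr)
    assume "\<not> (\<forall>m\<in>F. c m = 0)"
    \<comment> \<open>A term with the fewest factors. Its leading monomial \<open>mu m0\<close>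
      receives nothing from longer products, and products of the same length have leading monomials
      of their own.\<close>
    then obtain m0 where m0: "m0 \<in> F" "c m0 \<noteq> 0"
      and min: "\<And>m. m \<in> F \<Longrightarrow> c m \<noteq> 0 \<Longrightarrow> size m0 \<le> size m"
      using ex_has_least_nat[of "\<lambda>m. m \<in> F \<and> c m \<noteq> 0" _ size] by blast
    have size_mu: "size (mu m) = size m" for m by (simp add: mu_def)
    have coeff: "coeff (\<Prod>n\<in>#mu m. g n) (mu m0) = (if m = m0 then \<Prod>n\<in>#mu m0. a n else 0)"
      if "m \<in> F" "c m \<noteq> 0" for m
    proof -
      have "order_ge (Suc (size (mu m))) ((\<Prod>n\<in>#mu m. g n) - Poly_Mapping.single (mu m) (\<Prod>n\<in>#mu m. a n))"
        by (rule order_ge_prod_mset_leading) (use lead mu(2)[OF that(1)] in auto)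
      then have "coeff (\<Prod>n\<in>#mu m. g n) (mu m0) = coeff (Poly_Mapping.single (mu m) (\<Prod>n\<in>#mu m. a n)) (mu m0)"
        using order_ge_coeff[of _ _ "mu m0"] min[OF that] by (fastforce simp: lookup_minus size_mu)
      moreover have "mu m = mu m0 \<longleftrightarrow> m = m0" using mu(1) that m0 by metis
      ultimately show ?thesis by (auto simp: lookup_single)
    qed
    have "coeff q (mu m0) = (\<Sum>m\<in>F. if m = m0 then c m0 * (\<Prod>n\<in>#mu m0. a n) else 0)"
      unfolding q_def lookup_sum coeff_scale
    proof (intro sum.cong refl)
      fix m assume "m \<in> F"
      then show "c m * coeff (\<Prod>n\<in>#mu m. g n) (mu m0) = (if m = m0 then c m0 * (\<Prod>n\<in>#mu m0. a n) else 0)"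
        using coeff[of m] m0 by (cases "c m = 0") auto
    qed
    also have "\<dots> = c m0 * (\<Prod>n\<in>#mu m0. a n)" using F(1) m0 by simp
    finally have "(\<Prod>n\<in>#mu m0. a n) = 0" using \<open>q = 0\<close> m0 by simp
    then show False using nz mu(2)[OF m0(1)] by (auto simp: prod_mset_zero_iff)
  qed
qed

text \<open>Generators have no constant term, so a product of two or more has only monomials with at
  least two factors, while the empty product is constant. The monomial p_n must therefore come from
  a product of exactly one generator.\<close>

lemma exists_generator_with_linear_term:
  assumes "psum n \<in> sf_alg S"
    and S: "\<And>s. s \<in> S \<Longrightarrow> \<exists>q. psum_eval q = s \<and> parts_in {0<..} q \<and> order_ge 1 q"
    and "0 < n"
  shows "\<exists>q. psum_eval q \<in> S \<and> parts_in {0<..} q \<and> coeff q {#n#} \<noteq> 0"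
proof -
  obtain rep where rep: "\<And>s. s \<in> S \<Longrightarrow> psum_eval (rep s) = s \<and> parts_in {0<..} (rep s) \<and> order_ge 1 (rep s)"
    using S by metis
  obtain F c where F: "finite F" "\<forall>m\<in>F. set_mset m \<subseteq> S" "psum n = (\<lambda>M. \<Sum>m\<in>F. c m * sf_mprod m M)"
    using sf_algE[OF assms(1)] .
  define q where "q = (\<Sum>m\<in>F. Poly_Mapping.single {#} (c m) * (\<Prod>s\<in>#m. rep s))"
  have image: "image_mset (\<lambda>s. psum_eval (rep s)) m = m" if "m \<in> F" for m
  proof -
    have "image_mset (\<lambda>s. psum_eval (rep s)) m = image_mset id m"
      by (intro image_mset_cong) (use F(2)[rule_format, OF that] rep in auto)
    then show ?thesis by simp
  qed
  have "psum_eval q = psum n"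
    unfolding q_def psum_eval_combination F(3) by (intro ext sum.cong) (auto simp: image)
  also have "psum n = psum_eval (Poly_Mapping.single {#n#} 1)"
    by (simp add: sf_mult_sf_one_right)
  finally have eval: "psum_eval q = psum_eval (Poly_Mapping.single {#n#} 1)" .
  have "parts_in {0<..} q"
    unfolding q_def
    by (intro parts_in_sum parts_in_mult parts_in_prod_mset parts_in_single) (use F(2) rep in auto)
  \<comment> \<open>Linear independence turns the equality of series into one of polynomials, whose
    coefficients can be compared.\<close>
  then have "q = Poly_Mapping.single {#n#} 1"
    using eval assms(3) by (intro psum_eval_inj parts_in_single) auto
  then have "coeff q {#n#} \<noteq> 0" by simp
  then have "(\<Sum>m\<in>F. c m * coeff (\<Prod>s\<in>#m. rep s) {#n#}) \<noteq> 0"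
    unfolding q_def lookup_sum coeff_scale .
  then obtain m where "m \<in> F" "c m * coeff (\<Prod>s\<in>#m. rep s) {#n#} \<noteq> 0"
    by (rule sum.not_neutral_contains_not_neutral)
  then have m: "m \<in> F" "coeff (\<Prod>s\<in>#m. rep s) {#n#} \<noteq> 0" by auto
  have "order_ge (size m) (\<Prod>s\<in>#m. rep s)"
    by (rule order_ge_prod_mset) (use F(2)[rule_format, OF m(1)] rep in auto)
  with m(2) have "size m \<le> 1" using order_ge_coeff[of "size m" _ "{#n#}"] by fastforce
  moreover have "m \<noteq> {#}" using m(2) by (auto simp: lookup_one when_def)
  ultimately have "size m = 1" by (simp add: le_Suc_eq)
  then obtain s where "m = {#s#}" using size_1_singleton_mset by blast
  then show ?thesis using m F(2)[rule_format, OF m(1)] rep[of s] by (intro exI[of _ "rep s"]) auto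
qed

text \<open>By homogeneity, every term of \<open>g n\<close> other than p_n is a product of p_r with
  odd r < n. Strong induction on \<open>n\<close> places those in the algebra, and dividing by the
  nonzero coefficient recovers p_n.\<close>

lemma sf_alg_eq_Gamma:
  assumes odd: "\<And>n. odd n \<Longrightarrow> parts_in {r. odd r} (g n)"
    and homog: "\<And>n lam. odd n \<Longrightarrow> lam \<in> Poly_Mapping.keys (g n) \<Longrightarrow> sum_mset lam = n"
    and nz: "\<And>n. odd n \<Longrightarrow> coeff (g n) {#n#} \<noteq> 0"
  shows "sf_alg ((\<lambda>n. psum_eval (g n)) ` {n. odd n}) = Gamma" (is "sf_alg ?S = _")
proof
  show "sf_alg ?S \<subseteq> Gamma"
  proof
    fix f assume "f \<in> sf_alg ?S"
    then obtain F c where F: "finite F" "\<forall>m\<in>F. set_mset m \<subseteq> ?S" "f = (\<lambda>M. \<Sum>m\<in>F. c m * sf_mprod m M)"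
      by (rule sf_algE)
    define rep where "rep s = (SOME q. psum_eval q = s \<and> parts_in {r. odd r} q)" for s
    have rep: "psum_eval (rep s) = s \<and> parts_in {r. odd r} (rep s)" if "s \<in> ?S" for s
      unfolding rep_def by (rule someI_ex) (use that odd in auto)
    define q where "q = (\<Sum>m\<in>F. Poly_Mapping.single {#} (c m) * (\<Prod>s\<in>#m. rep s))"
    have image: "image_mset (\<lambda>s. psum_eval (rep s)) m = m" if "m \<in> F" for m
    proof -
      have "image_mset (\<lambda>s. psum_eval (rep s)) m = image_mset id m"
        by (intro image_mset_cong) (use F(2)[rule_format, OF that] rep in auto)
      then show ?thesis by simp
    qed
    have "psum_eval q = f"
      unfolding q_def psum_eval_combination F(3) by (intro ext sum.cong) (auto simp: image)
    moreover have "parts_in {r. odd r} q"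
      unfolding q_def
      by (intro parts_in_sum parts_in_mult parts_in_prod_mset parts_in_single) (use F(2) rep in auto)
    ultimately show "f \<in> Gamma" by (auto simp: Gamma_eq)
  qed
  \<comment> \<open>The preimage of the generated algebra is closed under sums and products and
    contains the constants, so it suffices to find each p_n with odd n in it.\<close>
  define D where "D = {q. psum_eval q \<in> sf_alg ?S}"
  have D_add: "q \<in> D \<Longrightarrow> r \<in> D \<Longrightarrow> q + r \<in> D" for q r
    by (simp add: D_def psum_eval_add sf_alg_add)
  have D_mult: "q \<in> D \<Longrightarrow> r \<in> D \<Longrightarrow> q * r \<in> D" for q r
    by (simp add: D_def psum_eval_mult sf_alg_mult)
  have D_sum: "(\<And>i. i \<in> I \<Longrightarrow> f i \<in> D) \<Longrightarrow> sum f I \<in> D" for f :: "nat multiset \<Rightarrow> ppoly" and I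
    by (simp add: D_def psum_eval_sum sf_alg_sum)
  have D_const: "Poly_Mapping.single {#} c \<in> D" for c
    by (simp add: D_def sf_alg_one sf_alg_scale)
  have D_prod: "(\<And>r. r \<in># lam \<Longrightarrow> Poly_Mapping.single {#r#} 1 \<in> D) \<Longrightarrow> Poly_Mapping.single lam c \<in> D" for lam c
  proof (induction lam)
    case empty
    show ?case by (rule D_const)
  next
    case (add r lam)
    then have "Poly_Mapping.single {#r#} 1 * Poly_Mapping.single lam c \<in> D" by (intro D_mult) auto
    then show ?case by (simp add: mult_single)
  qed
  have psum_D: "odd n \<Longrightarrow> Poly_Mapping.single {#n#} 1 \<in> D" for n
  proof (induction n rule: less_induct)
    case (less n)
    let ?a = "coeff (g n) {#n#}"
    have key: "Poly_Mapping.single lam (- coeff (g n) lam) \<in> D"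
      if "lam \<in> Poly_Mapping.keys (g n) - {{#n#}}" for lam
    proof (rule D_prod)
      fix r assume r: "r \<in># lam"
      have odd_lam: "set_mset lam \<subseteq> {r. odd r}" using odd[OF less.prems] that by (auto simp: parts_in_def)
      obtain mu where mu: "lam = add_mset r mu" using r by (metis insert_DiffM)
      \<comment> \<open>Odd parts are positive, so a zero sum would leave \<open>r\<close> as the
        only part and make \<open>lam\<close> the excluded key \<open>{#n#}\<close>. A positive
        remainder gives \<open>r < n\<close>.\<close>
      have "sum_mset mu \<noteq> 0"
      proof
        assume 0: "sum_mset mu = 0"
        then have "mu = {#}" using odd_lam mu by (cases mu) auto
        then show False using that mu homog[OF less.prems, of lam] by auto
      qed
      moreover have "n = r + sum_mset mu" using homog[OF less.prems, of lam] that mu by auto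
      ultimately have "r < n" by linarith
      moreover have "odd r" using odd_lam r by auto
      ultimately show "Poly_Mapping.single {#r#} 1 \<in> D" by (rule less.IH)
    qed
    let ?K = "Poly_Mapping.keys (g n) - {{#n#}}"
    have "g n = (\<Sum>lam\<in>insert {#n#} ?K. Poly_Mapping.single lam (coeff (g n) lam))"
      by (rule ppoly_eq_sum_single) auto
    also have "\<dots> = Poly_Mapping.single {#n#} ?a + (\<Sum>lam\<in>?K. Poly_Mapping.single lam (coeff (g n) lam))"
      by (subst sum.insert) auto
    finally have eq: "Poly_Mapping.single {#n#} ?a = g n + (\<Sum>lam\<in>?K. Poly_Mapping.single lam (- coeff (g n) lam))"
      by (simp add: single_uminus sum_negf eq_diff_eq)
    have "g n \<in> D" using less.prems by (auto simp: D_def intro: subsetD[OF sf_alg_superset])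
    then have "g n + (\<Sum>lam\<in>?K. Poly_Mapping.single lam (- coeff (g n) lam)) \<in> D"
      by (intro D_add D_sum key)
    then have "Poly_Mapping.single {#n#} ?a \<in> D" by (simp only: eq)
    then have "Poly_Mapping.single {#} (inverse ?a) * Poly_Mapping.single {#n#} ?a \<in> D"
      using D_mult D_const by blast
    then show ?case using nz[OF less.prems] by (simp add: mult_single)
  qed
  have "q \<in> D" if "parts_in {r. odd r} q" for q
  proof -
    have "(\<Sum>lam\<in>Poly_Mapping.keys q. Poly_Mapping.single lam (coeff q lam)) \<in> D"
      by (rule D_sum, rule D_prod, rule psum_D) (use that in \<open>auto simp: parts_in_def\<close>)
    moreover have "q = (\<Sum>lam\<in>Poly_Mapping.keys q. Poly_Mapping.single lam (coeff q lam))"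
      by (rule ppoly_eq_sum_single) auto
    ultimately show ?thesis by metis
  qed
  then show "Gamma \<subseteq> sf_alg ?S" by (auto simp: Gamma_eq D_def)
qed

section \<open>The power sum expansion of chromatic symmetric functions\<close>

text \<open>The vertex set is the union of the blocks rather than a parameter, so that a single
  block can be split off in an induction.\<close>

definition block_colorings :: "nat set set \<Rightarrow> nat multiset \<Rightarrow> (nat \<Rightarrow> nat) set" where
  "block_colorings P M = {\<kappa>. \<kappa> \<in> extensional (\<Union>P) \<and> (\<forall>B\<in>P. \<forall>u\<in>B. \<forall>v\<in>B. \<kappa> u = \<kappa> v) \<and>
      image_mset \<kappa> (mset_set (\<Union>P)) = M}"

lemma finite_colorings:
  assumes "finite V"
  shows "finite {\<kappa>. \<kappa> \<in> extensional V \<and> Q \<kappa> \<and> image_mset \<kappa> (mset_set V) = M}"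
proof (rule finite_subset)
  show "{\<kappa>. \<kappa> \<in> extensional V \<and> Q \<kappa> \<and> image_mset \<kappa> (mset_set V) = M} \<subseteq> V \<rightarrow>\<^sub>E set_mset M"
    using assms by (auto simp: PiE_def)
  show "finite (V \<rightarrow>\<^sub>E set_mset M)" using assms by (intro finite_PiE) auto
qed

text \<open>A monochromatic block forces \<open>N\<close> to be \<open>card B\<close> copies of one
  colour, which \<open>N\<close> determines because \<open>B\<close> is nonempty; only the colouring
  of the other blocks remains free. The right-hand side is one summand of the convolution
  \<open>sf_mult\<close>.\<close>

lemma card_block_colorings_fiber:
  assumes P: "finite (\<Union>P)" and B: "finite B" "B \<noteq> {}" "B \<inter> \<Union>P = {}" and N: "N \<subseteq># M"
  shows "rat_of_nat (card {\<kappa> \<in> block_colorings (insert B P) M. image_mset \<kappa> (mset_set B) = N})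
    = psum (card B) N * of_nat (card (block_colorings P (M - N)))" (is "of_nat (card ?L) = _")
proof -
  let ?U = "\<Union>P"
  have union: "image_mset \<kappa> (mset_set (\<Union>(insert B P))) = image_mset \<kappa> (mset_set B) + image_mset \<kappa> (mset_set ?U)" for \<kappa>
    using mset_set_Union[OF B(1) P B(3)] by simp
  have const: "image_mset \<kappa> (mset_set B) = replicate_mset (card B) i" if "\<And>x. x \<in> B \<Longrightarrow> \<kappa> x = i" for \<kappa> :: "nat \<Rightarrow> nat" and i
  proof -
    have "image_mset \<kappa> (mset_set B) = image_mset (\<lambda>_. i) (mset_set B)"
      by (intro image_mset_cong) (use that B(1) in auto)
    then show ?thesis by (simp add: image_mset_const_eq)
  qed
  have card_B: "0 < card B" using B by (simp add: card_gt_0_iff)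
  show ?thesis
  proof (cases "\<exists>i. N = replicate_mset (card B) i")
    case True
    then obtain i where i: "N = replicate_mset (card B) i" by auto
    have val: "\<kappa> x = i" if "\<kappa> \<in> ?L" "x \<in> B" for \<kappa> x
    proof -
      have "N = image_mset \<kappa> (mset_set B)" using that(1) by simp
      then have "\<kappa> x \<in># N" using that(2) B(1) by simp
      then show ?thesis using card_B by (simp add: i)
    qed
    have "bij_betw (\<lambda>\<kappa>. restrict \<kappa> ?U) ?L (block_colorings P (M - N))"
    proof (rule bij_betw_byWitness[where f' = "\<lambda>\<kappa> x. if x \<in> B then i else \<kappa> x"])
      show "\<forall>\<kappa>\<in>?L. (\<lambda>x. if x \<in> B then i else restrict \<kappa> ?U x) = \<kappa>"
      proof (intro ballI ext)
        fix \<kappa> x assume \<kappa>: "\<kappa> \<in> ?L"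
        then have "\<kappa> \<in> extensional (\<Union>(insert B P))" by (simp add: block_colorings_def)
        then have "x \<notin> B \<Longrightarrow> x \<notin> ?U \<Longrightarrow> \<kappa> x = undefined" by (simp add: extensional_def)
        then show "(if x \<in> B then i else restrict \<kappa> ?U x) = \<kappa> x"
          using val[OF \<kappa>, of x] by (simp add: restrict_def)
      qed
      show "\<forall>\<kappa>\<in>block_colorings P (M - N). restrict (\<lambda>x. if x \<in> B then i else \<kappa> x) ?U = \<kappa>"
      proof (intro ballI ext)
        fix \<kappa> x assume "\<kappa> \<in> block_colorings P (M - N)"
        then have "\<kappa> \<in> extensional ?U" by (simp add: block_colorings_def)
        moreover have "x \<in> ?U \<Longrightarrow> x \<notin> B" using B(3) by blast
        ultimately show "restrict (\<lambda>x. if x \<in> B then i else \<kappa> x) ?U x = \<kappa> x"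
          by (simp add: restrict_def extensional_def)
      qed
      show "(\<lambda>\<kappa>. restrict \<kappa> ?U) ` ?L \<subseteq> block_colorings P (M - N)"
      proof clarify
        fix \<kappa> assume \<kappa>: "\<kappa> \<in> block_colorings (insert B P) M" "N = image_mset \<kappa> (mset_set B)"
        have "image_mset (restrict \<kappa> ?U) (mset_set ?U) = image_mset \<kappa> (mset_set ?U)"
          by (intro image_mset_cong) (simp add: P)
        also have "\<dots> = M - image_mset \<kappa> (mset_set B)"
          using \<kappa>(1) unfolding block_colorings_def mem_Collect_eq union by (metis add_diff_cancel_left')
        finally have "image_mset (restrict \<kappa> ?U) (mset_set ?U) = M - image_mset \<kappa> (mset_set B)" .
        moreover have "restrict \<kappa> ?U u = restrict \<kappa> ?U v" if "C \<in> P" "u \<in> C" "v \<in> C" for C u v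
        proof -
          have "u \<in> ?U" "v \<in> ?U" "\<kappa> u = \<kappa> v" using that \<kappa>(1) unfolding block_colorings_def by blast+
          then show ?thesis by simp
        qed
        ultimately show "restrict \<kappa> ?U \<in> block_colorings P (M - image_mset \<kappa> (mset_set B))"
          unfolding block_colorings_def by blast
      qed
      show "(\<lambda>\<kappa> x. if x \<in> B then i else \<kappa> x) ` block_colorings P (M - N) \<subseteq> ?L"
      proof (rule image_subsetI)
        fix \<kappa> assume \<kappa>: "\<kappa> \<in> block_colorings P (M - N)"
        let ?k = "\<lambda>x. if x \<in> B then i else \<kappa> x"
        have "image_mset ?k (mset_set ?U) = image_mset \<kappa> (mset_set ?U)"
          by (intro image_mset_cong) (use P B(3) in auto)
        moreover have kB: "image_mset ?k (mset_set B) = N" unfolding i by (rule const) simp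
        ultimately have "image_mset ?k (mset_set (\<Union>(insert B P))) = M"
          unfolding union using \<kappa> N by (simp only: block_colorings_def mem_Collect_eq) simp
        moreover have "?k u = ?k v" if "C \<in> insert B P" "u \<in> C" "v \<in> C" for C u v
        proof (cases "C = B")
          case False
          then have "C \<in> P" "u \<notin> B" "v \<notin> B" using that B(3) by auto
          moreover have "\<kappa> u = \<kappa> v"
            using \<kappa> that \<open>C \<in> P\<close> unfolding block_colorings_def by blast
          ultimately show ?thesis by simp
        qed (use that in simp)
        moreover have "?k \<in> extensional (\<Union>(insert B P))"
          using \<kappa> by (simp add: block_colorings_def extensional_def)
        ultimately show "?k \<in> ?L" using kB unfolding block_colorings_def by blast
      qed
    qed
    then have "card ?L = card (block_colorings P (M - N))" by (rule bij_betw_same_card)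
    moreover have "psum (card B) N = 1" using card_B i by (auto simp: psum_def)
    ultimately show ?thesis by simp
  next
    case False
    obtain b where b: "b \<in> B" using B(2) by auto
    have "image_mset \<kappa> (mset_set B) \<noteq> N" if "\<kappa> \<in> block_colorings (insert B P) M" for \<kappa>
    proof -
      have "\<kappa> x = \<kappa> b" if "x \<in> B" for x
        using \<open>\<kappa> \<in> _\<close> b that unfolding block_colorings_def by blast
      then show ?thesis using const[of \<kappa> "\<kappa> b"] False by metis
    qed
    then have "?L = {}" by blast
    moreover have "psum (card B) N = 0" using False unfolding psum_def by simp
    ultimately show ?thesis by (simp only: card.empty of_nat_0 mult_zero_left)
  qed
qed

text \<open>p_\<lambda> is the generating function of colourings constant on blocks of sizes
  \<lambda>. Grouping the colourings by the colours used on a new block reproduces multiplication by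
  its power sum.\<close>

lemma psum_part_eq_card_block_colorings:
  assumes "finite P" "disjoint P" "\<And>B. B \<in> P \<Longrightarrow> finite B \<and> B \<noteq> {}"
  shows "psum_part (image_mset card (mset_set P)) M = of_nat (card (block_colorings P M))"
  using assms
proof (induction P arbitrary: M rule: finite_induct)
  case empty
  have "block_colorings {} M = (if M = {#} then {\<lambda>_. undefined} else {})"
    by (auto simp: block_colorings_def extensional_def)
  then show ?case by (simp add: sf_one_def)
next
  case (insert B P)
  have fin: "finite (\<Union>P)" using insert.hyps insert.prems(2) by auto
  have B: "finite B" "B \<noteq> {}" "B \<inter> \<Union>P = {}"
    using insert.prems insert.hyps by (auto simp: pairwise_insert disjnt_def)
  have IH: "psum_part (image_mset card (mset_set P)) M = of_nat (card (block_colorings P M))" for M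
    using insert.prems by (intro insert.IH) (auto simp: pairwise_insert)
  let ?C = "block_colorings (insert B P) M"
  have "finite ?C"
    unfolding block_colorings_def by (rule finite_colorings) (use fin B in auto)
  moreover have "(\<lambda>\<kappa>. image_mset \<kappa> (mset_set B)) ` ?C \<subseteq> {N. N \<subseteq># M}"
    using mset_set_Union[OF B(1) fin B(3)] by (auto simp: block_colorings_def)
  ultimately have "rat_of_nat (card ?C) = (\<Sum>N\<in>{N. N \<subseteq># M}. of_nat (card {\<kappa> \<in> ?C. image_mset \<kappa> (mset_set B) = N}))"
    using sum.group[of ?C "{N. N \<subseteq># M}" "\<lambda>\<kappa>. image_mset \<kappa> (mset_set B)" "\<lambda>_. 1 :: rat"]
    by (simp add: finite_subset_mset)
  also have "\<dots> = (\<Sum>N\<in>{N. N \<subseteq># M}. psum (card B) N * psum_part (image_mset card (mset_set P)) (M - N))"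
    using card_block_colorings_fiber[OF fin B] by (intro sum.cong) (auto simp: IH)
  also have "\<dots> = psum_part (image_mset card (mset_set (insert B P))) M"
    using insert.hyps by (simp add: sf_mult_def)
  finally show ?case by simp
qed

text \<open>Each undirected edge is listed once, as a pair with increasing entries.\<close>

definition edges :: "(nat \<Rightarrow> nat \<Rightarrow> bool) \<Rightarrow> (nat \<times> nat) set" where
  "edges E = {(u, v). E u v \<and> u < v}"

text \<open>The closure is reflexive on all natural numbers; restricting both ends to
  \<open>V\<close> makes it an equivalence on \<open>V\<close>, in which isolated vertices form
  classes of their own.\<close>

definition connection :: "nat set \<Rightarrow> (nat \<times> nat) set \<Rightarrow> (nat \<times> nat) set" where
  "connection V S = {(u, v). u \<in> V \<and> v \<in> V \<and> (u, v) \<in> (S \<union> S\<inverse>)\<^sup>*}"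

definition components :: "nat set \<Rightarrow> (nat \<times> nat) set \<Rightarrow> nat set set" where
  "components V S = V // connection V S"

definition graph_type :: "nat set \<Rightarrow> (nat \<times> nat) set \<Rightarrow> nat multiset" where
  "graph_type V S = image_mset card (mset_set (components V S))"

lemma sym_rtrancl_Un_converse: "sym ((S \<union> S\<inverse>)\<^sup>*)"
  by (intro sym_rtrancl sym_Un_converse)

lemma equiv_connection: "equiv V (connection V S)"
  using sym_rtrancl_Un_converse[of S]
  by (auto simp: connection_def intro!: equivI refl_onI symI transI dest: symD)

lemma partition_on_components: "partition_on V (components V S)"
  unfolding components_def by (rule partition_on_quotient) (rule equiv_connection)

lemma same_component_iff:
  "(\<exists>B\<in>components V S. u \<in> B \<and> v \<in> B) \<longleftrightarrow> (u, v) \<in> connection V S"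
proof
  assume "\<exists>B\<in>components V S. u \<in> B \<and> v \<in> B"
  then show "(u, v) \<in> connection V S"
    unfolding components_def using quotient_eq_iff[OF equiv_connection] by blast
next
  assume uv: "(u, v) \<in> connection V S"
  then have "u \<in> V" by (simp add: connection_def)
  moreover have "(u, u) \<in> connection V S" using \<open>u \<in> V\<close> by (simp add: connection_def)
  ultimately show "\<exists>B\<in>components V S. u \<in> B \<and> v \<in> B"
    using uv unfolding components_def by (intro bexI[of _ "connection V S `` {u}"]) (auto intro: quotientI)
qed

text \<open>No edge leaves a block, so components lie inside blocks; a centre that reaches its whole
  block gives the converse. Checking one vertex per block avoids arguing about paths between
  arbitrary pairs.\<close>

lemma components_eqI:
  assumes P: "partition_on V P"
    and edge: "\<And>u v. (u, v) \<in> S \<Longrightarrow> \<exists>B\<in>P. u \<in> B \<and> v \<in> B"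
    and center: "\<And>B. B \<in> P \<Longrightarrow> \<exists>c\<in>B. \<forall>v\<in>B. (c, v) \<in> (S \<union> S\<inverse>)\<^sup>*"
  shows "components V S = P"
proof -
  have uniq: "B = C" if "B \<in> P" "C \<in> P" "x \<in> B" "x \<in> C" for B C x
    using P that by (auto simp: partition_on_def pairwise_def disjnt_def)
  have V: "V = \<Union>P" using P by (rule partition_onD1)
  have stay: "\<exists>B\<in>P. u \<in> B \<and> v \<in> B" if "(u, v) \<in> (S \<union> S\<inverse>)\<^sup>*" "u \<in> V" for u v
    using that
  proof (induction rule: rtrancl_induct)
    case base
    then show ?case using V by auto
  next
    case (step v w)
    then obtain B where B: "B \<in> P" "u \<in> B" "v \<in> B" by auto
    obtain C where "C \<in> P" "v \<in> C" "w \<in> C" using step.hyps(2) edge by blast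
    with B uniq show ?case by blast
  qed
  have "connection V S = {(u, v). \<exists>B\<in>P. u \<in> B \<and> v \<in> B}"
  proof (intro set_eqI iffI)
    fix p assume "p \<in> connection V S"
    then show "p \<in> {(u, v). \<exists>B\<in>P. u \<in> B \<and> v \<in> B}" using stay by (auto simp: connection_def)
  next
    fix p assume "p \<in> {(u, v). \<exists>B\<in>P. u \<in> B \<and> v \<in> B}"
    then obtain u v B where p: "p = (u, v)" "B \<in> P" "u \<in> B" "v \<in> B" by auto
    then obtain c where "(c, u) \<in> (S \<union> S\<inverse>)\<^sup>*" "(c, v) \<in> (S \<union> S\<inverse>)\<^sup>*" using center by blast
    then have "(u, v) \<in> (S \<union> S\<inverse>)\<^sup>*"
      using sym_rtrancl_Un_converse[of S] by (meson rtrancl_trans symD)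
    then show "p \<in> connection V S" using p V by (auto simp: connection_def)
  qed
  then show ?thesis unfolding components_def using partition_on_eq_quotient[OF P] by simp
qed

lemma finite_components: "finite V \<Longrightarrow> finite (components V S)"
  using finite_elements partition_on_components by blast

lemma component_finite_nonempty: "finite V \<Longrightarrow> B \<in> components V S \<Longrightarrow> finite B \<and> B \<noteq> {}"
  using partition_on_components[of V S] by (metis Union_upper finite_subset partition_onD1 partition_onD3)

lemma sum_graph_type: "finite V \<Longrightarrow> sum_mset (graph_type V S) = card V"
proof -
  assume V: "finite V"
  have "card V = card (\<Union>(components V S))"
    using partition_onD1[OF partition_on_components] by metis
  also have "\<dots> = sum card (components V S)"
    using component_finite_nonempty[OF V] partition_onD2[OF partition_on_components]
    by (intro card_Union_disjoint) auto
  finally show ?thesis by (simp add: graph_type_def sum_unfold_sum_mset)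
qed

lemma graph_type_pos: "finite V \<Longrightarrow> set_mset (graph_type V S) \<subseteq> {0<..}"
  using component_finite_nonempty[of V] finite_components[of V]
  by (auto simp: graph_type_def card_gt_0_iff)

text \<open>Equality of colours propagates along paths, so being constant on components is a
  condition on the edges of \<open>S\<close> alone. This is the form in which inclusion-exclusion
  produces it.\<close>

lemma block_colorings_components:
  assumes "S \<subseteq> V \<times> V"
  shows "block_colorings (components V S) M = {\<kappa>. \<kappa> \<in> extensional V \<and> S \<subseteq> {(u, v). \<kappa> u = \<kappa> v} \<and>
      image_mset \<kappa> (mset_set V) = M}"
proof -
  have V: "\<Union>(components V S) = V" using partition_onD1[OF partition_on_components] by metis
  have "(\<forall>B\<in>components V S. \<forall>u\<in>B. \<forall>v\<in>B. \<kappa> u = \<kappa> v) \<longleftrightarrow> S \<subseteq> {(u, v). \<kappa> u = \<kappa> v}" for \<kappa> :: "nat \<Rightarrow> nat"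
  proof -
    have "(\<forall>B\<in>components V S. \<forall>u\<in>B. \<forall>v\<in>B. \<kappa> u = \<kappa> v) \<longleftrightarrow> (\<forall>u v. (u, v) \<in> connection V S \<longrightarrow> \<kappa> u = \<kappa> v)"
      using same_component_iff[of V S] by blast
    also have "\<dots> \<longleftrightarrow> S \<subseteq> {(u, v). \<kappa> u = \<kappa> v}"
    proof
      assume "\<forall>u v. (u, v) \<in> connection V S \<longrightarrow> \<kappa> u = \<kappa> v"
      then show "S \<subseteq> {(u, v). \<kappa> u = \<kappa> v}" using assms by (auto simp: connection_def)
    next
      assume mono: "S \<subseteq> {(u, v). \<kappa> u = \<kappa> v}"
      have "\<kappa> u = \<kappa> v" if "(u, v) \<in> (S \<union> S\<inverse>)\<^sup>*" for u v
        using that by (induction rule: rtrancl_induct) (use mono in auto)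
      then show "\<forall>u v. (u, v) \<in> connection V S \<longrightarrow> \<kappa> u = \<kappa> v" by (auto simp: connection_def)
    qed
    finally show ?thesis .
  qed
  then show ?thesis unfolding block_colorings_def V by simp
qed

text \<open>Expands the product of \<open>1 - 1\<close> over \<open>A\<close>. Applied to the set of
  monochromatic edges, it is the indicator of a proper colouring.\<close>

lemma sum_Pow_sign: "finite A \<Longrightarrow> (\<Sum>S\<in>Pow A. (- 1) ^ card S) = (if A = {} then 1 else 0 :: rat)"
  using prod_diff_conv_sum[of A "\<lambda>_. 1 :: rat" "\<lambda>_. 1"] by (simp add: power_0_left)

definition chrom_poly :: "nat set \<Rightarrow> (nat \<Rightarrow> nat \<Rightarrow> bool) \<Rightarrow> ppoly" where
  "chrom_poly V E = (\<Sum>S\<in>Pow (edges E). Poly_Mapping.single (graph_type V S) ((- 1) ^ card S))"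

section \<open>Inclusion-exclusion over edge sets\<close>

lemma edges_subset: "simple_graph V E \<Longrightarrow> edges E \<subseteq> V \<times> V"
  by (auto simp: edges_def simple_graph_def)

lemma finite_edges: "simple_graph V E \<Longrightarrow> finite (edges E)"
  using edges_subset[of V E] by (meson finite_SigmaI finite_subset simple_graph_def)

lemma proper_coloring_iff:
  assumes "simple_graph V E"
  shows "proper_coloring V E \<kappa> \<longleftrightarrow> {(u, v) \<in> edges E. \<kappa> u = \<kappa> v} = {}"
proof
  assume "proper_coloring V E \<kappa>"
  then show "{(u, v) \<in> edges E. \<kappa> u = \<kappa> v} = {}"
    using edges_subset[OF assms] by (auto simp: proper_coloring_def edges_def)
next
  assume *: "{(u, v) \<in> edges E. \<kappa> u = \<kappa> v} = {}"
  show "proper_coloring V E \<kappa>"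
    unfolding proper_coloring_def
  proof (intro ballI impI)
    fix u v assume "E u v"
    then have "u < v \<or> v < u" "E v u" using assms by (auto simp: simple_graph_def) (metis linorder_neqE_nat)
    moreover have "\<kappa> a \<noteq> \<kappa> b" if "E a b" "a < b" for a b using * that by (auto simp: edges_def)
    ultimately show "\<kappa> u \<noteq> \<kappa> v" using \<open>E u v\<close> by metis
  qed
qed

text \<open>The indicator of properness is a signed sum over sets of monochromatic edges. After the
  two sums are exchanged, an edge set \<open>S\<close> contributes the number of colourings constant
  on its components, which is a coefficient of p_\<lambda>.\<close>

lemma chrom_sf_eq_psum_eval:
  assumes G: "simple_graph V E"
  shows "chrom_sf V E = psum_eval (chrom_poly V E)"
proof
  fix M :: "nat multiset"
  have V: "finite V" using G by (simp add: simple_graph_def)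
  \<comment> \<open>The conjunct \<open>True\<close> matches the free predicate in
    \<open>finite_colorings\<close>.\<close>
  let ?K = "{\<kappa>. \<kappa> \<in> extensional V \<and> True \<and> image_mset \<kappa> (mset_set V) = M}"
  let ?mono = "\<lambda>\<kappa>. {(u, v) \<in> edges E. \<kappa> u = \<kappa> v}"
  have K: "finite ?K" by (rule finite_colorings[OF V])
  have fin: "finite (edges E)" by (rule finite_edges[OF G])
  have "chrom_sf V E M = of_nat (card {\<kappa> \<in> ?K. proper_coloring V E \<kappa>})"
    unfolding chrom_sf_def by (intro arg_cong[of _ _ "\<lambda>A. of_nat (card A)"]) auto
  also have "\<dots> = (\<Sum>\<kappa>\<in>?K. if proper_coloring V E \<kappa> then 1 else 0)"
    using K by (simp add: sum.If_cases Int_def)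
  also have "\<dots> = (\<Sum>\<kappa>\<in>?K. \<Sum>S\<in>Pow (?mono \<kappa>). (- 1) ^ card S)"
    using fin by (intro sum.cong refl, subst sum_Pow_sign)
      (auto simp: proper_coloring_iff[OF G] intro: finite_subset)
  also have "\<dots> = (\<Sum>\<kappa>\<in>?K. \<Sum>S\<in>Pow (edges E). if S \<subseteq> ?mono \<kappa> then (- 1) ^ card S else 0)"
    using fin by (intro sum.cong refl sum.mono_neutral_cong_left) auto
  also have "\<dots> = (\<Sum>S\<in>Pow (edges E). \<Sum>\<kappa>\<in>?K. if S \<subseteq> ?mono \<kappa> then (- 1) ^ card S else 0)"
    by (rule sum.swap)
  also have "\<dots> = (\<Sum>S\<in>Pow (edges E). (- 1) ^ card S * psum_part (graph_type V S) M)"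
  proof (intro sum.cong refl)
    fix S assume S: "S \<in> Pow (edges E)"
    then have SV: "S \<subseteq> V \<times> V" using edges_subset[OF G] by auto
    have "psum_part (graph_type V S) M = of_nat (card (block_colorings (components V S) M))"
      unfolding graph_type_def
      by (rule psum_part_eq_card_block_colorings)
        (use component_finite_nonempty[OF V] finite_components[OF V] partition_onD2[OF partition_on_components] in auto)
    also have "block_colorings (components V S) M = {\<kappa> \<in> ?K. S \<subseteq> ?mono \<kappa>}"
      unfolding block_colorings_components[OF SV] using S by auto
    finally show "(\<Sum>\<kappa>\<in>?K. if S \<subseteq> ?mono \<kappa> then (- 1) ^ card S else 0) = (- 1) ^ card S * psum_part (graph_type V S) M"
      using K by (simp add: sum.If_cases Int_def mult.commute)
  qed
  also have "\<dots> = psum_eval (chrom_poly V E) M"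
    by (simp add: chrom_poly_def psum_eval_sum)
  finally show "chrom_sf V E M = psum_eval (chrom_poly V E) M" .
qed

lemma coeff_chrom_poly:
  "coeff (chrom_poly V E) lam = (\<Sum>S\<in>Pow (edges E). if graph_type V S = lam then (- 1) ^ card S else 0)"
  unfolding chrom_poly_def lookup_sum by (intro sum.cong) (auto simp: lookup_single when_def)

lemma keys_chrom_poly:
  assumes "lam \<in> Poly_Mapping.keys (chrom_poly V E)"
  obtains S where "S \<subseteq> edges E" "graph_type V S = lam"
proof -
  from assms have "(\<Sum>S\<in>Pow (edges E). if graph_type V S = lam then (- 1) ^ card S else (0::rat)) \<noteq> 0"
    by (simp add: in_keys_iff coeff_chrom_poly)
  then obtain S where "S \<in> Pow (edges E)" "(if graph_type V S = lam then (- 1) ^ card S else (0::rat)) \<noteq> 0"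
    by (rule sum.not_neutral_contains_not_neutral)
  then show ?thesis using that by (auto split: if_splits)
qed

text \<open>A linear operator that is diagonal in the basis p_\<lambda>. Both \<open>omega\<close>
  and the projection onto terms of even sign are of this kind.\<close>

definition reweight :: "(nat multiset \<Rightarrow> rat) \<Rightarrow> ppoly \<Rightarrow> ppoly" where
  "reweight w q = (\<Sum>lam\<in>Poly_Mapping.keys q. Poly_Mapping.single lam (w lam * coeff q lam))"

lemma coeff_reweight: "coeff (reweight w q) lam = w lam * coeff q lam"
proof -
  have "coeff (reweight w q) lam = (\<Sum>mu\<in>Poly_Mapping.keys q. if mu = lam then w lam * coeff q lam else 0)"
    unfolding reweight_def lookup_sum by (intro sum.cong) (auto simp: lookup_single when_def)
  then show ?thesis by (auto simp: in_keys_iff)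
qed

text \<open>Any representation that competes in the \<open>THE\<close> consists of products with
  positive parts, so linear independence gives it the same coefficients and hence the same
  image.\<close>

lemma omega_psum_eval:
  assumes q: "parts_in {0<..} q"
  shows "omega (psum_eval q) = psum_eval (reweight omega_sign q)"
  unfolding omega_def
proof (rule the_equality)
  let ?P = "Poly_Mapping.keys q"
  have "psum_eval (reweight omega_sign q) = lincomb ?P (\<lambda>lam. omega_sign lam * coeff q lam)"
    by (simp add: reweight_def psum_eval_sum lincomb_def)
  moreover have "\<forall>lam\<in>?P. is_partition lam" using q by (simp add: parts_in_def is_partition_iff)
  ultimately show "\<exists>P c. finite P \<and> (\<forall>lam\<in>P. is_partition lam) \<and> psum_eval q = lincomb P c \<and>
      psum_eval (reweight omega_sign q) = lincomb P (\<lambda>lam. omega_sign lam * c lam)"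
    by (intro exI[of _ ?P] exI[of _ "coeff q"]) (simp add: psum_eval_def)
next
  fix g
  assume "\<exists>P c. finite P \<and> (\<forall>lam\<in>P. is_partition lam) \<and> psum_eval q = lincomb P c \<and>
      g = lincomb P (\<lambda>lam. omega_sign lam * c lam)"
  then obtain P c where P: "finite P" "\<forall>lam\<in>P. is_partition lam" "psum_eval q = lincomb P c"
    and g: "g = lincomb P (\<lambda>lam. omega_sign lam * c lam)" by blast
  define r where "r = (\<Sum>lam\<in>P. Poly_Mapping.single lam (c lam))"
  have "parts_in {0<..} r"
    unfolding r_def by (intro parts_in_sum parts_in_single) (use P(2) in \<open>auto simp: is_partition_iff\<close>)
  then have "q = r"
    using q P(3) by (intro psum_eval_inj) (simp_all add: lincomb_eq_psum_eval r_def)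
  have coeff_r: "coeff r lam = (if lam \<in> P then c lam else 0)" for lam
  proof -
    have "coeff r lam = (\<Sum>mu\<in>P. if mu = lam then c lam else 0)"
      unfolding r_def lookup_sum by (intro sum.cong) (auto simp: lookup_single when_def)
    then show ?thesis using P(1) by simp
  qed
  \<comment> \<open>Only an inclusion holds, because a representation may list partitions with
    coefficient zero.\<close>
  have "Poly_Mapping.keys (reweight omega_sign q) \<subseteq> P"
    by (auto simp: in_keys_iff coeff_reweight \<open>q = r\<close> coeff_r split: if_splits)
  then have "psum_eval (reweight omega_sign q) = lincomb P (coeff (reweight omega_sign q))"
    using P(1) by (rule psum_eval_superset[rotated])
  also have "\<dots> = g"
    unfolding g lincomb_def by (intro ext sum.cong) (auto simp: coeff_reweight \<open>q = r\<close> coeff_r)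
  finally show "g = psum_eval (reweight omega_sign q)" by simp
qed

section \<open>Near chromatic functions as polynomials in the power sums\<close>

definition near_poly :: "nat set \<Rightarrow> (nat \<Rightarrow> nat \<Rightarrow> bool) \<Rightarrow> ppoly" where
  "near_poly V E = reweight (\<lambda>lam. (1 + omega_sign lam) / 2) (chrom_poly V E)"

lemma coeff_near_poly:
  "coeff (near_poly V E) lam = (if even (sum_mset lam - size lam) then coeff (chrom_poly V E) lam else 0)"
  by (simp add: near_poly_def coeff_reweight omega_sign_def)

lemma keys_near_poly:
  assumes "lam \<in> Poly_Mapping.keys (near_poly V E)"
  obtains S where "S \<subseteq> edges E" "graph_type V S = lam" "even (sum_mset lam - size lam)"
proof -
  from assms have "lam \<in> Poly_Mapping.keys (chrom_poly V E)" "even (sum_mset lam - size lam)"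
    by (auto simp: in_keys_iff coeff_near_poly split: if_splits)
  then show ?thesis using that keys_chrom_poly by metis
qed

lemma near_poly_pos: "finite V \<Longrightarrow> parts_in {0<..} (near_poly V E)"
  unfolding parts_in_def by (metis graph_type_pos keys_near_poly)

lemma near_poly_homogeneous:
  "finite V \<Longrightarrow> lam \<in> Poly_Mapping.keys (near_poly V E) \<Longrightarrow> sum_mset lam = card V"
  by (metis sum_graph_type keys_near_poly)

lemma near_chrom_sf_eq_psum_eval:
  assumes G: "simple_graph V E"
  shows "near_chrom_sf V E = psum_eval (near_poly V E)"
proof -
  have V: "finite V" using G by (simp add: simple_graph_def)
  let ?q = "chrom_poly V E"
  have "parts_in {0<..} ?q"
    unfolding parts_in_def by (metis V graph_type_pos keys_chrom_poly)
  then have "omega (chrom_sf V E) = psum_eval (reweight omega_sign ?q)"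
    by (simp add: chrom_sf_eq_psum_eval[OF G] omega_psum_eval)
  then show ?thesis
    unfolding near_chrom_sf_def chrom_sf_eq_psum_eval[OF G] near_poly_def
    by (simp add: reweight_def psum_eval_sum psum_eval_def[of ?q] lincomb_def fun_eq_iff
        sum.distrib[symmetric] sum_divide_distrib field_simps)
qed

section \<open>Connected partitions of stars, triangles and matchings\<close>

lemma partition_on_center_singletons:
  assumes "W \<subseteq> V" "W \<noteq> {}"
  shows "partition_on V (insert W ((\<lambda>x. {x}) ` (V - W)))"
  using assms by (subst partition_on_insert) (auto simp: disjnt_def partition_on_singletons)

lemma graph_type_star:
  assumes V: "finite V" "c \<in> V" and J: "J \<subseteq> V - {c}"
  shows "graph_type V (Pair c ` J) = add_mset (card J + 1) (replicate_mset (card V - 1 - card J) 1)"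
proof -
  let ?W = "insert c J"
  let ?Q = "(\<lambda>x. {x}) ` (V - ?W)"
  have W: "?W \<subseteq> V" "finite J" "c \<notin> J" using V J by (auto intro: finite_subset)
  have comp: "components V (Pair c ` J) = insert ?W ?Q"
  proof (rule components_eqI)
    show "partition_on V (insert ?W ?Q)" by (rule partition_on_center_singletons) (use W in auto)
    show "\<exists>c'\<in>B. \<forall>v\<in>B. (c', v) \<in> (Pair c ` J \<union> (Pair c ` J)\<inverse>)\<^sup>*" if "B \<in> insert ?W ?Q" for B
    proof (cases "B = ?W")
      case True
      have "(c, v) \<in> (Pair c ` J \<union> (Pair c ` J)\<inverse>)\<^sup>*" if "v \<in> ?W" for v
        using that by auto
      then show ?thesis using True by blast
    qed (use that in auto)
  qed auto
  have "?W \<notin> ?Q" by auto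
  moreover have "finite ?Q" using V by simp
  moreover have "image_mset card (mset_set ?Q) = replicate_mset (card V - 1 - card J) 1"
  proof -
    have "mset_set ?Q = image_mset (\<lambda>x. {x}) (mset_set (V - ?W))"
      by (rule image_mset_mset_set[symmetric]) (simp add: inj_on_def)
    moreover have "card (V - ?W) = card V - 1 - card J"
      using W V by (simp add: card_Diff_subset)
    ultimately show ?thesis by (simp add: multiset.map_comp comp_def image_mset_const_eq)
  qed
  ultimately show ?thesis
    unfolding graph_type_def comp using W by simp
qed

lemma graph_type_connected:
  assumes "S \<subseteq> V \<times> V" "c \<in> V" "\<And>v. v \<in> V \<Longrightarrow> (c, v) \<in> (S \<union> S\<inverse>)\<^sup>*"
  shows "graph_type V S = {#card V#}"
proof -
  have "components V S = {V}"
    by (rule components_eqI) (use assms in \<open>auto intro: partition_on_space\<close>)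
  then show ?thesis by (simp add: graph_type_def)
qed

text \<open>The first step of a path from \<open>v\<close> to any other vertex is an edge at
  \<open>v\<close>.\<close>

lemma graph_type_connected_no_isolated:
  assumes V: "finite V" "2 \<le> card V" "v \<in> V" and conn: "graph_type V S = {#card V#}"
  shows "\<exists>w. (v, w) \<in> S \<or> (w, v) \<in> S"
proof -
  have "card (components V S) = 1"
    using arg_cong[OF conn, of size] by (simp add: graph_type_def)
  then obtain B where "components V S = {B}" by (auto simp: card_1_singleton_iff)
  then have B: "components V S = {V}" using partition_onD1[OF partition_on_components[of V S]] by simp
  obtain w where w: "w \<in> V" "w \<noteq> v"
    using V by (metis card_le_Suc0_iff_eq not_less_eq_eq numeral_2_eq_2)
  then have "(v, w) \<in> connection V S" using same_component_iff[of V S v w] B V(3) by auto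
  then have "(v, w) \<in> (S \<union> S\<inverse>)\<^sup>*" by (simp add: connection_def)
  then show ?thesis by (cases rule: converse_rtranclE) (use w in auto)
qed

lemma graph_type_two_edges:
  assumes V: "finite V" and e: "a \<in> V" "b \<in> V" "c \<in> V" "d \<in> V" "distinct [a, b, c, d]"
  shows "graph_type V {(a, b), (c, d)} = add_mset 2 (add_mset 2 (replicate_mset (card V - 4) 1))"
proof -
  let ?S = "{(a, b), (c, d)}" and ?W = "{a, b, c, d}"
  let ?Q = "(\<lambda>x. {x}) ` (V - ?W)"
  have comp: "components V ?S = insert {a, b} (insert {c, d} ?Q)"
  proof (rule components_eqI)
    have "V - {a, b} - {c, d} = V - ?W" by auto
    then show "partition_on V (insert {a, b} (insert {c, d} ?Q))"
      using e by (auto simp: partition_on_insert disjnt_def partition_on_singletons)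
    show "\<exists>x\<in>B. \<forall>v\<in>B. (x, v) \<in> (?S \<union> ?S\<inverse>)\<^sup>*" if "B \<in> insert {a, b} (insert {c, d} ?Q)" for B
      using that by auto
  qed auto
  have notin: "{a, b} \<notin> insert {c, d} ?Q" "{c, d} \<notin> ?Q" using e by (auto simp: doubleton_eq_iff)
  have "image_mset card (mset_set ?Q) = replicate_mset (card V - 4) 1"
  proof -
    have "mset_set ?Q = image_mset (\<lambda>x. {x}) (mset_set (V - ?W))"
      by (rule image_mset_mset_set[symmetric]) (simp add: inj_on_def)
    moreover have "card (V - ?W) = card V - 4"
      using e V by (subst card_Diff_subset) auto
    ultimately show ?thesis by (simp add: multiset.map_comp comp_def image_mset_const_eq)
  qed
  moreover have "card {a, b} = 2" "card {c, d} = 2" using e by auto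
  ultimately show ?thesis
    unfolding graph_type_def comp using notin V by simp
qed

text \<open>All components have at most two vertices, so an edge fills its component, and conversely
  a two-vertex component contains an edge. Listing edges as increasing pairs makes this a bijection.
  Consequently all edge sets of this type carry the sign +1.\<close>

lemma card_edges_of_two_edges_type:
  assumes V: "finite V" and S: "S \<subseteq> V \<times> V" "\<And>u v. (u, v) \<in> S \<Longrightarrow> u < v"
    and ty: "graph_type V S = add_mset 2 (add_mset 2 (replicate_mset k 1))"
  shows "card S = 2"
proof -
  let ?C = "{B \<in> components V S. card B = 2}"
  have fin: "finite (components V S)" by (rule finite_components[OF V])
  have mem: "card B \<in> {1, 2}" if "B \<in> components V S" for B
  proof -
    have "card B \<in># graph_type V S" using that fin by (auto simp: graph_type_def)
    then show ?thesis unfolding ty by (auto split: if_splits)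
  qed
  have "count (graph_type V S) 2 = (\<Sum>B | B \<in># mset_set (components V S) \<and> 2 = card B. count (mset_set (components V S)) B)"
    unfolding graph_type_def by (rule count_image_mset')
  also have "\<dots> = (\<Sum>B\<in>?C. 1)" using fin by (intro sum.cong) auto
  finally have "card ?C = count (graph_type V S) 2" by simp
  then have two: "card ?C = 2" by (simp add: ty)
  have "bij_betw (\<lambda>(u, v). {u, v}) S ?C"
  proof (rule bij_betw_imageI)
    show "inj_on (\<lambda>(u, v). {u, v}) S"
    proof (rule inj_onI)
      fix x y assume "x \<in> S" "y \<in> S" "(case x of (u, v) \<Rightarrow> {u, v}) = (case y of (u, v) \<Rightarrow> {u, v})"
      then show "x = y" using S(2)[of "fst x" "snd x"] S(2)[of "fst y" "snd y"]
        by (auto simp: doubleton_eq_iff split: prod.splits)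
    qed
    show "(\<lambda>(u, v). {u, v}) ` S = ?C"
    proof (intro equalityI subsetI)
      fix B assume "B \<in> (\<lambda>(u, v). {u, v}) ` S"
      then obtain u v where uv: "(u, v) \<in> S" "B = {u, v}" by auto
      then have "(u, v) \<in> connection V S" using S(1) by (auto simp: connection_def)
      then obtain C where C: "C \<in> components V S" "u \<in> C" "v \<in> C" using same_component_iff by blast
      have "u < v" by (rule S(2)[OF uv(1)])
      then have "card {u, v} = 2" by simp
      moreover have "finite C" using component_finite_nonempty[OF V C(1)] by simp
      moreover have "{u, v} \<subseteq> C" using C by simp
      moreover have "card C \<le> 2" using mem[OF C(1)] by auto
      ultimately have "C = {u, v}" by (metis card_seteq)
      then show "B \<in> ?C" using C(1) uv(2) \<open>card {u, v} = 2\<close> by simp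
    next
      fix B assume B: "B \<in> ?C"
      then obtain u v where uv: "B = {u, v}" "u \<noteq> v" by (auto simp: card_2_iff)
      then have "(u, v) \<in> connection V S" using B same_component_iff[of V S u v] by auto
      then have "(u, v) \<in> (S \<union> S\<inverse>)\<^sup>*" by (simp add: connection_def)
      \<comment> \<open>The path from \<open>u\<close> to \<open>v\<close> starts with an edge at
        \<open>u\<close>; that edge stays in the component \<open>{u, v}\<close>, so its other end
        is \<open>v\<close>.\<close>
      then obtain w where w: "(u, w) \<in> S \<union> S\<inverse>"
        using uv(2) by (auto elim: converse_rtranclE)
      then have "(u, w) \<in> connection V S" using S(1) by (auto simp: connection_def)
      then obtain C where C: "C \<in> components V S" "u \<in> C" "w \<in> C" using same_component_iff by blast
      have "C = B"
      proof (rule ccontr)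
        assume "C \<noteq> B"
        then have "disjnt C B"
          using pairwiseD[OF partition_onD2[OF partition_on_components] C(1), of B] B by simp
        then show False using C uv by (auto simp: disjnt_iff)
      qed
      moreover have "w \<noteq> u" using w S(2) by auto
      ultimately have "w = v" using C uv by auto
      then show "B \<in> (\<lambda>(u, v). {u, v}) ` S" using w uv by (auto simp: image_iff insert_commute)
    qed
  qed
  then show ?thesis using two by (simp add: bij_betw_same_card)
qed

text \<open>With every sign equal to +1, the coefficient is the number of edge sets of this type,
  and the given pair is one of them.\<close>

lemma coeff_two_edges:
  assumes G: "simple_graph V E" and e: "(a, b) \<in> edges E" "(c, d) \<in> edges E" "{a, b} \<inter> {c, d} = {}"
  shows "coeff (chrom_poly V E) (add_mset 2 (add_mset 2 (replicate_mset (card V - 4) 1))) \<noteq> 0"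
proof -
  let ?T = "add_mset 2 (add_mset 2 (replicate_mset (card V - 4) 1))"
  have V: "finite V" using G by (simp add: simple_graph_def)
  have fin: "finite (Pow (edges E))" using finite_edges[OF G] by simp
  have "card S = 2" if "S \<in> Pow (edges E)" "graph_type V S = ?T" for S
    using card_edges_of_two_edges_type[OF V _ _ that(2)] that(1) edges_subset[OF G]
    by (auto simp: edges_def)
  then have "coeff (chrom_poly V E) ?T = (\<Sum>S\<in>Pow (edges E). if graph_type V S = ?T then 1 else 0)"
    unfolding coeff_chrom_poly by (intro sum.cong) auto
  also have "\<dots> = of_nat (card {S \<in> Pow (edges E). graph_type V S = ?T})"
    using fin by (simp add: sum.If_cases Int_def)
  also have "\<dots> \<noteq> 0"
  proof -
    have ty: "graph_type V {(a, b), (c, d)} = ?T"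
      using e edges_subset[OF G] by (intro graph_type_two_edges[OF V]) (auto simp: edges_def)
    have "{(a, b), (c, d)} \<in> {S \<in> Pow (edges E). graph_type V S = ?T}"
      unfolding mem_Collect_eq ty using e by simp
    then have "{S \<in> Pow (edges E). graph_type V S = ?T} \<noteq> {}" by (metis empty_iff)
    moreover have "finite {S \<in> Pow (edges E). graph_type V S = ?T}" using fin by (rule finite_subset[rotated]) blast
    ultimately show ?thesis by (simp only: of_nat_eq_0_iff card_eq_0_iff) simp
  qed
  finally show ?thesis .
qed

section \<open>Stars and the triangle\<close>

lemma simple_graph_star: "simple_graph (star_V n) (star_E n)"
  by (auto simp: simple_graph_def star_V_def star_E_def)

lemma simple_graph_C3: "simple_graph C3_V C3_E"
  by (auto simp: simple_graph_def C3_V_def C3_E_def)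

lemma edges_star: "edges (star_E n) = Pair 0 ` {1..<n}"
  by (auto simp: edges_def star_E_def image_iff)

lemma edges_C3: "edges C3_E = {(0, 1), (0, 2), (1, 2)}"
  by (auto simp: edges_def C3_E_def)

lemma graph_type_star_subset:
  assumes "0 < n" "S \<subseteq> edges (star_E n)"
  shows "graph_type (star_V n) S = add_mset (card S + 1) (replicate_mset (n - 1 - card S) 1)"
    and "card S \<le> n - 1"
proof -
  obtain J where J: "J \<subseteq> {1..<n}" "S = Pair 0 ` J"
    using assms(2) by (auto simp: edges_star subset_image_iff)
  have "card S = card J" unfolding J(2) by (intro card_image inj_onI) simp
  moreover have "card J \<le> n - 1" using card_mono[OF _ J(1)] by simp
  moreover have "graph_type (star_V n) S = add_mset (card J + 1) (replicate_mset (card (star_V n) - 1 - card J) 1)"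
    unfolding J(2) by (rule graph_type_star) (use J assms(1) in \<open>auto simp: star_V_def\<close>)
  ultimately show "graph_type (star_V n) S = add_mset (card S + 1) (replicate_mset (n - 1 - card S) 1)"
    "card S \<le> n - 1" by (simp_all add: star_V_def)
qed

text \<open>For the hook of \<open>S\<close>, the difference \<open>sum_mset lam - size lam\<close>
  is \<open>card S\<close>. Its parity thus selects exactly the hooks whose large part
  \<open>card S + 1\<close> is odd.\<close>

lemma near_poly_star_odd:
  assumes "0 < n"
  shows "parts_in {r. odd r} (near_poly (star_V n) (star_E n))"
  unfolding parts_in_def
proof
  fix lam assume "lam \<in> Poly_Mapping.keys (near_poly (star_V n) (star_E n))"
  then obtain S where S: "S \<subseteq> edges (star_E n)" "graph_type (star_V n) S = lam"
    and ev: "even (sum_mset lam - size lam)" by (rule keys_near_poly)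
  note ty = graph_type_star_subset[OF assms S(1)]
  have "sum_mset lam - size lam = card S"
    unfolding S(2)[symmetric] ty(1) using ty(2) by simp
  then have "odd (card S + 1)" using ev by simp
  then show "set_mset lam \<subseteq> {r. odd r}" unfolding S(2)[symmetric] ty(1) by auto
qed

text \<open>Removing any edge disconnects a tree, so only the full edge set contributes. Oddness of
  \<open>n\<close> makes \<open>n - 1\<close> even, so the term survives the projection.\<close>

lemma coeff_near_poly_star:
  assumes "odd n"
  shows "coeff (near_poly (star_V n) (star_E n)) {#n#} \<noteq> 0"
proof -
  have n: "0 < n" using assms by (rule odd_pos)
  have fin: "finite (edges (star_E n))" by (simp add: edges_star)
  have card_edges: "card (edges (star_E n)) = n - 1"
    unfolding edges_star by (subst card_image) (auto simp: inj_on_def)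
  have "graph_type (star_V n) S = {#n#} \<longleftrightarrow> S = edges (star_E n)" if "S \<subseteq> edges (star_E n)" for S
  proof
    assume "graph_type (star_V n) S = {#n#}"
    then have "card S + 1 = n"
      using graph_type_star_subset[OF n that] by (auto simp: add_mset_eq_singleton_iff)
    then show "S = edges (star_E n)" using that fin card_edges by (intro card_subset_eq) auto
  next
    assume "S = edges (star_E n)"
    then show "graph_type (star_V n) S = {#n#}"
      using graph_type_star_subset(1)[OF n that] n card_edges by simp
  qed
  then have "coeff (chrom_poly (star_V n) (star_E n)) {#n#} =
      (\<Sum>S\<in>Pow (edges (star_E n)). if S = edges (star_E n) then (- 1) ^ card S else 0)"
    unfolding coeff_chrom_poly by (intro sum.cong) auto
  also have "\<dots> \<noteq> 0" using fin by simp
  finally show ?thesis using assms by (simp add: coeff_near_poly)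
qed

text \<open>The only partition of 3 with an even part is (2,1), and it has the wrong parity: 3 - 2 =
  1.\<close>

lemma near_poly_C3_odd: "parts_in {r. odd r} (near_poly C3_V C3_E)"
  unfolding parts_in_def
proof (intro ballI subsetI CollectI)
  fix lam r assume lam: "lam \<in> Poly_Mapping.keys (near_poly C3_V C3_E)" and r: "r \<in># lam"
  have fin: "finite C3_V" and card: "card C3_V = 3" by (simp_all add: C3_V_def)
  have sum: "sum_mset lam = 3" using near_poly_homogeneous[OF fin lam] card by simp
  have pos: "set_mset lam \<subseteq> {0<..}" using near_poly_pos[OF fin] lam by (auto simp: parts_in_def)
  have ev: "even (3 - size lam)" using lam sum by (auto elim: keys_near_poly)
  show "odd r"
  proof
    assume "even r"
    obtain mu where mu: "lam = add_mset r mu" using r by (metis insert_DiffM)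
    have "0 < r" "r \<le> 3" using pos sum mu by auto
    then have "r = 2" using \<open>even r\<close> by presburger
    then have mu1: "sum_mset mu = 1" using sum mu by simp
    then obtain s nu where nu: "mu = add_mset s nu" by (cases mu) auto
    then have "s + sum_mset nu = 1" "0 < s" using mu1 pos mu by simp_all
    then have "sum_mset nu = 0" by linarith
    then have "nu = {#}" using pos mu nu by (cases nu) auto
    then show False using ev mu nu by simp
  qed
qed

text \<open>The connected spanning subgraphs are three paths with two edges, of sign +1, and the
  triangle itself, of sign -1. The coefficient is 3 - 1 = 2.\<close>

lemma coeff_near_poly_C3: "coeff (near_poly C3_V C3_E) {#3#} \<noteq> 0"
proof -
  have fin: "finite C3_V" and card: "card C3_V = 3" by (simp_all add: C3_V_def)
  have disconnected: "graph_type C3_V S \<noteq> {#3#}" if "v \<in> C3_V" "\<And>w. (v, w) \<notin> S \<and> (w, v) \<notin> S" for S v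
    using graph_type_connected_no_isolated[OF fin _ that(1), of S] that(2) card by auto
  have connected: "graph_type C3_V S = {#3#}"
    if "S \<subseteq> C3_V \<times> C3_V" "c \<in> C3_V" "C3_V \<subseteq> insert c {v. (c, v) \<in> S \<union> S\<inverse>}" for S c
    using graph_type_connected[OF that(1,2)] that(3) card by (auto intro: r_into_rtrancl)
  have "graph_type C3_V {} \<noteq> {#3#}" "graph_type C3_V {(1, 2)} \<noteq> {#3#}"
    by (rule disconnected[of 0]; simp add: C3_V_def)+
  moreover have "graph_type C3_V {(0, 1)} \<noteq> {#3#}"
    by (rule disconnected[of 2]; simp add: C3_V_def)
  moreover have "graph_type C3_V {(0, 2)} \<noteq> {#3#}"
    by (rule disconnected[of 1]; simp add: C3_V_def)
  moreover have "graph_type C3_V {(0, 1), (0, 2)} = {#3#}" "graph_type C3_V {(0, 1), (0, 2), (1, 2)} = {#3#}"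
    by (rule connected[of _ 0]; simp add: C3_V_def)+
  moreover have "graph_type C3_V {(0, 1), (1, 2)} = {#3#}"
    by (rule connected[of _ 1]; simp add: C3_V_def)
  moreover have "graph_type C3_V {(0, 2), (1, 2)} = {#3#}"
    by (rule connected[of _ 2]; simp add: C3_V_def)
  ultimately have "coeff (chrom_poly C3_V C3_E) {#3#} = 2"
    unfolding coeff_chrom_poly edges_C3
    by (simp add: Pow_insert image_insert doubleton_eq_iff insert_eq_iff)
  then show ?thesis by (simp add: coeff_near_poly)
qed

section \<open>Graphs without two disjoint edges\<close>

text \<open>Colourings are pulled back along \<open>f\<close>. Graphs may have arbitrary natural
  numbers as vertices, and this identifies them with the fixed models of star and triangle.\<close>

lemma chrom_sf_iso:
  assumes V: "finite V" and f: "bij_betw f V V'"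
    and E: "\<And>u v. u \<in> V \<Longrightarrow> v \<in> V \<Longrightarrow> E u v \<longleftrightarrow> E' (f u) (f v)"
  shows "chrom_sf V E = chrom_sf V' E'"
proof
  fix M :: "nat multiset"
  let ?A = "{\<kappa>. \<kappa> \<in> extensional V \<and> proper_coloring V E \<kappa> \<and> image_mset \<kappa> (mset_set V) = M}"
  let ?B = "{\<kappa>. \<kappa> \<in> extensional V' \<and> proper_coloring V' E' \<kappa> \<and> image_mset \<kappa> (mset_set V') = M}"
  have inj: "inj_on f V" and V': "V' = f ` V" using f by (auto simp: bij_betw_def)
  have inv: "inv_into V f (f x) = x" if "x \<in> V" for x using inj that by simp
  have "bij_betw (\<lambda>\<kappa>. restrict (\<lambda>x. \<kappa> (f x)) V) ?B ?A"
  proof (rule bij_betw_byWitness[where f' = "\<lambda>\<kappa>. restrict (\<lambda>y. \<kappa> (inv_into V f y)) V'"])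
    show "\<forall>\<kappa>\<in>?B. restrict (\<lambda>y. restrict (\<lambda>x. \<kappa> (f x)) V (inv_into V f y)) V' = \<kappa>"
    proof (intro ballI ext)
      fix \<kappa> y assume "\<kappa> \<in> ?B"
      then show "restrict (\<lambda>y. restrict (\<lambda>x. \<kappa> (f x)) V (inv_into V f y)) V' y = \<kappa> y"
        by (cases "y \<in> V'") (auto simp: V' inv extensional_def)
    qed
    show "\<forall>\<kappa>\<in>?A. restrict (\<lambda>x. restrict (\<lambda>y. \<kappa> (inv_into V f y)) V' (f x)) V = \<kappa>"
    proof (intro ballI ext)
      fix \<kappa> x assume "\<kappa> \<in> ?A"
      then show "restrict (\<lambda>x. restrict (\<lambda>y. \<kappa> (inv_into V f y)) V' (f x)) V x = \<kappa> x"
        by (cases "x \<in> V") (auto simp: V' inv extensional_def)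
    qed
    show "(\<lambda>\<kappa>. restrict (\<lambda>x. \<kappa> (f x)) V) ` ?B \<subseteq> ?A"
    proof (rule image_subsetI)
      fix \<kappa> assume \<kappa>: "\<kappa> \<in> ?B"
      have "image_mset (restrict (\<lambda>x. \<kappa> (f x)) V) (mset_set V) = image_mset (\<lambda>x. \<kappa> (f x)) (mset_set V)"
        by (intro image_mset_cong) (simp add: V)
      also have "\<dots> = image_mset \<kappa> (mset_set V')"
        unfolding V' image_mset_mset_set[OF inj, symmetric] by (simp add: multiset.map_comp comp_def)
      finally show "restrict (\<lambda>x. \<kappa> (f x)) V \<in> ?A"
        using \<kappa> E by (auto simp: proper_coloring_def V')
    qed
    show "(\<lambda>\<kappa>. restrict (\<lambda>y. \<kappa> (inv_into V f y)) V') ` ?A \<subseteq> ?B"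
    proof (rule image_subsetI)
      fix \<kappa> assume \<kappa>: "\<kappa> \<in> ?A"
      let ?k = "restrict (\<lambda>y. \<kappa> (inv_into V f y)) V'"
      have "image_mset ?k (mset_set V') = image_mset (\<lambda>x. ?k (f x)) (mset_set V)"
        unfolding V' image_mset_mset_set[OF inj, symmetric] by (simp add: multiset.map_comp comp_def)
      also have "\<dots> = image_mset \<kappa> (mset_set V)"
        by (intro image_mset_cong) (simp add: V V' inv)
      finally show "?k \<in> ?B"
        using \<kappa> E by (auto simp: proper_coloring_def V' inv)
    qed
  qed
  then show "chrom_sf V E M = chrom_sf V' E' M"
    unfolding chrom_sf_def by (simp add: bij_betw_same_card)
qed

lemma near_chrom_sf_iso:
  assumes "finite V" "bij_betw f V V'"
    and "\<And>u v. u \<in> V \<Longrightarrow> v \<in> V \<Longrightarrow> E u v \<longleftrightarrow> E' (f u) (f v)"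
  shows "near_chrom_sf V E = near_chrom_sf V' E'"
  unfolding near_chrom_sf_def using chrom_sf_iso[of V f V' E E'] assms by simp

lemma near_chrom_sf_star_shape:
  assumes V: "finite V" "c \<in> V"
    and E: "\<And>u v. E u v \<longleftrightarrow> u \<in> V \<and> v \<in> V \<and> u \<noteq> v \<and> (u = c \<or> v = c)"
  shows "near_chrom_sf V E = Y_star (card V)"
proof -
  let ?n = "card V"
  have n: "0 < ?n" using V by (auto simp: card_gt_0_iff)
  have "card (V - {c}) = card {1..<?n}" using V by simp
  then obtain g where g: "bij_betw g (V - {c}) {1..<?n}"
    using V finite_same_card_bij[of "V - {c}" "{1..<?n}"] by auto
  \<comment> \<open>The centre must go to 0, the centre in \<open>star_E\<close>; \<open>g\<close>
    numbers the leaves from 1.\<close>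
  define f where "f = g(c := 0)"
  have im: "g ` (V - {c}) = {1..<?n}" and inj: "inj_on g (V - {c})" using g by (auto simp: bij_betw_def)
  have f_pos: "f v \<in> {1..<?n}" if "v \<in> V" "v \<noteq> c" for v
    using im that by (auto simp: f_def)
  have f_c: "f c = 0" by (simp add: f_def)
  have inj_f: "inj_on f V"
  proof (rule inj_onI)
    fix u v assume "u \<in> V" "v \<in> V" "f u = f v"
    then show "u = v"
      using f_pos[of u] f_pos[of v] f_c inj by (cases "u = c"; cases "v = c") (auto simp: f_def inj_on_def)
  qed
  have "f ` V = insert 0 (g ` (V - {c}))"
    using V(2) by (auto simp: f_def)
  then have "f ` V = star_V ?n" using im n by (auto simp: star_V_def)
  then have bij: "bij_betw f V (star_V ?n)" using inj_f by (simp add: bij_betw_def)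
  have "E u v \<longleftrightarrow> star_E ?n (f u) (f v)" if "u \<in> V" "v \<in> V" for u v
  proof -
    have "f u < ?n" "f v < ?n" using bij that by (auto simp: bij_betw_def star_V_def)
    moreover have "f u = f v \<longleftrightarrow> u = v" using inj_f that by (simp add: inj_on_eq_iff)
    moreover have "f u = 0 \<longleftrightarrow> u = c" "f v = 0 \<longleftrightarrow> v = c" using f_pos f_c that by (metis atLeastLessThan_iff not_one_le_zero)+
    ultimately show ?thesis using that by (simp add: E star_E_def)
  qed
  then show ?thesis unfolding Y_star_def by (rule near_chrom_sf_iso[OF V(1) bij])
qed

lemma near_chrom_sf_triangle_shape:
  assumes V: "card V = 3" and E: "\<And>u v. E u v \<longleftrightarrow> u \<in> V \<and> v \<in> V \<and> u \<noteq> v"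
  shows "near_chrom_sf V E = Y_C3"
proof -
  have fin: "finite V" using V by (simp add: card_ge_0_finite)
  have C3: "C3_V = {0..<3}" by (auto simp: C3_V_def)
  obtain f where "bij_betw f V {0..<3::nat}"
    using finite_same_card_bij[of V "{0..<3::nat}"] fin V by auto
  then have f: "bij_betw f V C3_V" by (simp only: C3)
  have "E u v \<longleftrightarrow> C3_E (f u) (f v)" if "u \<in> V" "v \<in> V" for u v
  proof -
    have "f u < 3" "f v < 3" using f that by (auto simp: bij_betw_def C3)
    moreover have "f u = f v \<longleftrightarrow> u = v" using bij_betw_imp_inj_on[OF f] that by (simp add: inj_on_eq_iff)
    ultimately show ?thesis using that by (simp add: E C3_E_def)
  qed
  then show ?thesis unfolding Y_C3_def by (rule near_chrom_sf_iso[OF fin f])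
qed

text \<open>Fix an edge ab. If neither end meets all edges, the edge avoiding a passes through b to
  some c, and the edge avoiding b passes through a to some d. These two edges must meet, so c = d
  and a triangle appears.\<close>

lemma intersecting_edges_cases:
  assumes G: "simple_graph V E" and "V \<noteq> {}"
    and cover: "\<And>v. v \<in> V \<Longrightarrow> \<exists>w. E v w"
    and meet: "\<And>a b c d. E a b \<Longrightarrow> E c d \<Longrightarrow> {a, b} \<inter> {c, d} \<noteq> {}"
  shows "(\<exists>c\<in>V. \<forall>u v. E u v \<longleftrightarrow> u \<in> V \<and> v \<in> V \<and> u \<noteq> v \<and> (u = c \<or> v = c)) \<or>
    card V = 3 \<and> (\<forall>u v. E u v \<longleftrightarrow> u \<in> V \<and> v \<in> V \<and> u \<noteq> v)"
proof -
  have inV: "E u v \<Longrightarrow> u \<in> V \<and> v \<in> V \<and> u \<noteq> v" and sym: "E u v \<Longrightarrow> E v u" for u v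
    using G by (auto simp: simple_graph_def)
  have star: ?thesis if c: "\<And>u v. E u v \<Longrightarrow> u = c \<or> v = c" "c \<in> V" for c
  proof -
    have "E v c" if "v \<in> V" "v \<noteq> c" for v
      using cover[OF that(1)] c(1) that(2) by blast
    then have "E u v \<longleftrightarrow> u \<in> V \<and> v \<in> V \<and> u \<noteq> v \<and> (u = c \<or> v = c)" for u v
      using c inV sym by blast
    then show ?thesis using c(2) by blast
  qed
  obtain a b where ab: "E a b" using cover \<open>V \<noteq> {}\<close> by blast
  show ?thesis
  proof (cases "(\<forall>u v. E u v \<longrightarrow> u = a \<or> v = a) \<or> (\<forall>u v. E u v \<longrightarrow> u = b \<or> v = b)")
    case True
    then show ?thesis using star[of a] star[of b] inV[OF ab] by blast
  next
    case False
    then obtain u v u' v' where uv: "E u v" "u \<noteq> a" "v \<noteq> a" and uv': "E u' v'" "u' \<noteq> b" "v' \<noteq> b" by blast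
    obtain c where bc: "E b c" "c \<noteq> a"
      using meet[OF ab uv(1)] uv sym[OF uv(1)] by auto
    obtain d where ad: "E a d" "d \<noteq> b"
      using meet[OF ab uv'(1)] uv' sym[OF uv'(1)] by auto
    have "a \<noteq> b" "b \<noteq> c" using inV ab bc by blast+
    then have "d = c" using meet[OF bc(1) ad(1)] bc ad by auto
    then have ac: "E a c" using ad by simp
    \<comment> \<open>An edge with one end outside the triangle would have to meet all three sides
      in its other end, but no vertex lies on all three.\<close>
    have sub: "u \<in> {a, b, c}" if "E u v" for u v
      using meet[OF that ab] meet[OF that bc(1)] meet[OF that ac] \<open>a \<noteq> b\<close> \<open>b \<noteq> c\<close> bc(2) by auto
    have "V \<subseteq> {a, b, c}" using cover sub by blast
    then have V: "V = {a, b, c}" using inV ab bc by blast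
    moreover have "card {a, b, c} = 3" using \<open>a \<noteq> b\<close> \<open>b \<noteq> c\<close> bc(2) by auto
    moreover have "E u v \<longleftrightarrow> u \<in> V \<and> v \<in> V \<and> u \<noteq> v" for u v
      using inV V ab bc(1) ac sym by auto
    ultimately show ?thesis by auto
  qed
qed

section \<open>Graphs that can supply a linear term\<close>

lemma near_chrom_sf_generator_cases:
  assumes G: "simple_graph V E" and Gamma: "near_chrom_sf V E \<in> Gamma"
    and n: "0 < n" and lin: "coeff (near_poly V E) {#n#} \<noteq> 0"
  shows "near_chrom_sf V E = Y_star n \<or> n = 3 \<and> near_chrom_sf V E = Y_C3"
proof -
  have V: "finite V" using G by (simp add: simple_graph_def)
  have card: "card V = n"
    using near_poly_homogeneous[OF V, of "{#n#}" E] lin by (simp add: in_keys_iff)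
  have "V \<noteq> {}" using card n by auto
  obtain q where q: "parts_in {r. odd r} q" "psum_eval q = psum_eval (near_poly V E)"
    using Gamma near_chrom_sf_eq_psum_eval[OF G] by (auto simp: Gamma_eq)
  have "parts_in {0<..} q" using q(1) by (rule parts_in_mono) (auto intro: odd_pos)
  \<comment> \<open>Membership in \<open>Gamma\<close> only provides some representation with odd
    parts; uniqueness identifies it with \<open>near_poly V E\<close>.\<close>
  then have odd: "parts_in {r. odd r} (near_poly V E)"
    using psum_eval_inj[OF _ near_poly_pos[OF V] q(2)] q(1) by simp
  have meet_edges: "{a, b} \<inter> {c, d} \<noteq> {}" if e: "(a, b) \<in> edges E" "(c, d) \<in> edges E" for a b c d
  proof
    assume disj: "{a, b} \<inter> {c, d} = {}"
    let ?T = "add_mset 2 (add_mset 2 (replicate_mset (card V - 4) 1))"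
    have "{a, b, c, d} \<subseteq> V" using e edges_subset[OF G] by auto
    moreover have "card {a, b, c, d} = 4" using e disj by (auto simp: edges_def)
    \<comment> \<open>Ensures that the truncated subtraction \<open>card V - 4\<close> is a true
      one, so that the difference below is 2.\<close>
    ultimately have "4 \<le> card V" using card_mono[OF V] by metis
    then have "sum_mset ?T - size ?T = 2" by simp
    then have "?T \<in> Poly_Mapping.keys (near_poly V E)"
      using coeff_two_edges[OF G e disj] by (simp add: in_keys_iff coeff_near_poly)
    then show False using odd by (auto simp: parts_in_def)
  qed
  have edge: "(u, v) \<in> edges E \<or> (v, u) \<in> edges E" if "E u v" for u v
    using G that by (auto simp: edges_def simple_graph_def) (metis linorder_neqE_nat)
  have meet: "{a, b} \<inter> {c, d} \<noteq> {}" if "E a b" "E c d" for a b c d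
    using edge[OF that(1)] edge[OF that(2)] meet_edges[of a b c d] meet_edges[of b a c d]
      meet_edges[of a b d c] meet_edges[of b a d c]
    by (auto simp only: insert_commute)
  have cases: "near_chrom_sf V E = Y_star n \<or> n = 3 \<and> near_chrom_sf V E = Y_C3"
    if "\<And>v. v \<in> V \<Longrightarrow> \<exists>w. E v w"
  proof -
    have "(\<exists>c\<in>V. \<forall>u v. E u v \<longleftrightarrow> u \<in> V \<and> v \<in> V \<and> u \<noteq> v \<and> (u = c \<or> v = c)) \<or>
        card V = 3 \<and> (\<forall>u v. E u v \<longleftrightarrow> u \<in> V \<and> v \<in> V \<and> u \<noteq> v)"
      by (rule intersecting_edges_cases[OF G \<open>V \<noteq> {}\<close>]) (fact that, fact meet)
    then show ?thesis
    proof (elim disjE bexE conjE)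
      fix c assume "c \<in> V" "\<forall>u v. E u v \<longleftrightarrow> u \<in> V \<and> v \<in> V \<and> u \<noteq> v \<and> (u = c \<or> v = c)"
      then show ?thesis using near_chrom_sf_star_shape[OF V, of c E] card by simp
    next
      assume "card V = 3" "\<forall>u v. E u v \<longleftrightarrow> u \<in> V \<and> v \<in> V \<and> u \<noteq> v"
      then show ?thesis using near_chrom_sf_triangle_shape[of V E] card by simp
    qed
  qed
  show ?thesis
  proof (cases "n = 1")
    \<comment> \<open>A single vertex has no edge, so the covering argument does not apply; the
      graph is the star with no leaves.\<close>
    case True
    then obtain c where c: "V = {c}" using card by (auto simp: card_1_singleton_iff)
    then have "E u v \<longleftrightarrow> u \<in> V \<and> v \<in> V \<and> u \<noteq> v \<and> (u = c \<or> v = c)" for u v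
      using G by (auto simp: simple_graph_def)
    then show ?thesis using near_chrom_sf_star_shape[OF V, of c E] c card by simp
  next
    case False
    obtain S where S: "S \<subseteq> edges E" "graph_type V S = {#n#}"
      using keys_near_poly[of "{#n#}" V E] lin by (auto simp: in_keys_iff)
    show ?thesis
    proof (rule cases)
      fix v assume "v \<in> V"
      then obtain w where "(v, w) \<in> S \<or> (w, v) \<in> S"
        using graph_type_connected_no_isolated[OF V, of v S] S(2) card n False by auto
      then have "E v w" using S(1) G by (auto simp: edges_def simple_graph_def)
      then show "\<exists>w. E v w" by blast
    qed
  qed
qed

text \<open>By homogeneity a constant term occurs only when there are no vertices, and then Y is the
  constant 1.\<close>

lemma order_ge_near_poly:
  assumes G: "simple_graph V E" and "near_chrom_sf V E \<noteq> sf_one"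
  shows "order_ge 1 (near_poly V E)"
proof -
  have V: "finite V" using G by (simp add: simple_graph_def)
  have "V \<noteq> {}"
  proof
    assume "V = {}"
    then have "edges E = {}" using edges_subset[OF G] by simp
    then have "chrom_poly V E = 1"
      by (simp add: chrom_poly_def graph_type_def components_def \<open>V = {}\<close>)
    then have "near_poly V E = 1"
      by (intro poly_mapping_eqI) (auto simp: coeff_near_poly lookup_one when_def)
    then show False using assms(2) near_chrom_sf_eq_psum_eval[OF G] by simp
  qed
  then have "0 < card V" using V by (simp add: card_gt_0_iff)
  then have "lam \<noteq> {#}" if "lam \<in> Poly_Mapping.keys (near_poly V E)" for lam
    using near_poly_homogeneous[OF V that] by auto
  then show ?thesis by (auto simp: order_ge_def Suc_le_eq nonempty_has_size[symmetric])
qed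

text \<open>Treats both families at once. Among monomials of degree \<open>n\<close>, only p_n has
  fewer than two factors, so homogeneity alone supplies the leading terms that independence asks
  for.\<close>

lemma near_chrom_sf_family:
  assumes G: "\<And>n. odd n \<Longrightarrow> simple_graph (V n) (E n)" and card: "\<And>n. odd n \<Longrightarrow> card (V n) = n"
    and odd: "\<And>n. odd n \<Longrightarrow> parts_in {r. odd r} (near_poly (V n) (E n))"
    and lin: "\<And>n. odd n \<Longrightarrow> coeff (near_poly (V n) (E n)) {#n#} \<noteq> 0"
  shows "alg_indep ((\<lambda>n. near_chrom_sf (V n) (E n)) ` {n. odd n})"
    and "sf_alg ((\<lambda>n. near_chrom_sf (V n) (E n)) ` {n. odd n}) = Gamma"
proof -
  let ?g = "\<lambda>n. near_poly (V n) (E n)"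
  have fin: "finite (V n)" if "odd n" for n using G[OF that] by (simp add: simple_graph_def)
  have image: "(\<lambda>n. near_chrom_sf (V n) (E n)) ` {n. odd n} = (\<lambda>n. psum_eval (?g n)) ` {n. odd n}"
    by (intro image_cong) (auto simp: near_chrom_sf_eq_psum_eval[OF G])
  have homog: "sum_mset lam = n" if "odd n" "lam \<in> Poly_Mapping.keys (?g n)" for n lam
    using near_poly_homogeneous[OF fin[OF that(1)] that(2)] card that by simp
  have lead: "order_ge 2 (?g n - Poly_Mapping.single {#n#} (coeff (?g n) {#n#}))" if n: "odd n" for n
    unfolding order_ge_def
  proof
    fix lam assume "lam \<in> Poly_Mapping.keys (?g n - Poly_Mapping.single {#n#} (coeff (?g n) {#n#}))"
    then have ne: "lam \<noteq> {#n#}" and key: "lam \<in> Poly_Mapping.keys (?g n)"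
      by (auto simp: in_keys_iff lookup_minus lookup_single when_def split: if_splits)
    have sum: "sum_mset lam = n" by (rule homog[OF n key])
    show "2 \<le> size lam"
    proof (rule ccontr)
      assume "\<not> 2 \<le> size lam"
      then consider "size lam = 0" | "size lam = 1" by linarith
      then show False
      proof cases
        case 1
        then show False using sum odd_pos[OF n] by simp
      next
        case 2
        then obtain x where "lam = {#x#}" using size_1_singleton_mset by blast
        then show False using sum ne by simp
      qed
    qed
  qed
  show "alg_indep ((\<lambda>n. near_chrom_sf (V n) (E n)) ` {n. odd n})"
    unfolding image
    by (rule alg_indep_of_leading_terms[where a = "\<lambda>n. coeff (?g n) {#n#}"])
      (use fin lead lin in \<open>auto intro: near_poly_pos\<close>)
  show "sf_alg ((\<lambda>n. near_chrom_sf (V n) (E n)) ` {n. odd n}) = Gamma"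
    unfolding image by (rule sf_alg_eq_Gamma) (use odd homog lin in auto)
qed

lemma psum_in_Gamma:
  assumes "odd n"
  shows "psum n \<in> Gamma"
proof -
  have "psum n = psum_eval (Poly_Mapping.single {#n#} 1)" by (simp add: sf_mult_sf_one_right)
  moreover have "parts_in {r. odd r} (Poly_Mapping.single {#n#} 1)"
    using assms by (intro parts_in_single) auto
  ultimately show ?thesis unfolding Gamma_eq by (rule image_eqI[OF _ CollectI])
qed

text \<open>Independence bars the constant 1 from \<open>S\<close>, so every generator has order at
  least 1. Expressing p_n through the generators then singles out one with a linear term in p_n, to
  which the classification of graphs applies.\<close>

lemma near_chrom_generating_set_contains:
  assumes S: "S \<subseteq> {near_chrom_sf V E | V E. simple_graph V E}" "alg_indep S" "sf_alg S = Gamma"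
    and n: "odd n"
  shows "Y_star n \<in> S \<or> n = 3 \<and> Y_C3 \<in> S"
proof -
  have graph: "\<exists>V E. simple_graph V E \<and> s = near_chrom_sf V E" if "s \<in> S" for s
    using S(1) that by blast
  have fin: "simple_graph V E \<Longrightarrow> finite V" for V E by (simp add: simple_graph_def)
  have "\<exists>q. psum_eval q \<in> S \<and> parts_in {0<..} q \<and> coeff q {#n#} \<noteq> 0"
  proof (rule exists_generator_with_linear_term)
    show "psum n \<in> sf_alg S" using psum_in_Gamma[OF n] S(3) by simp
    show "0 < n" using n by (rule odd_pos)
    fix s assume s: "s \<in> S"
    then obtain V E where G: "simple_graph V E" "s = near_chrom_sf V E" using graph by blast
    have "s \<noteq> sf_one" using s sf_one_notin_alg_indep[OF S(2)] by blast
    then show "\<exists>q. psum_eval q = s \<and> parts_in {0<..} q \<and> order_ge 1 q"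
      using order_ge_near_poly[OF G(1)] near_chrom_sf_eq_psum_eval[OF G(1)]
        near_poly_pos[OF fin[OF G(1)]] G(2) by metis
  qed
  then obtain q where q: "psum_eval q \<in> S" "parts_in {0<..} q" "coeff q {#n#} \<noteq> 0" by blast
  obtain V E where G: "simple_graph V E" "psum_eval q = near_chrom_sf V E" using graph[OF q(1)] by blast
  then have "psum_eval q = psum_eval (near_poly V E)" by (simp add: near_chrom_sf_eq_psum_eval)
  then have "q = near_poly V E" by (rule psum_eval_inj[OF q(2) near_poly_pos[OF fin[OF G(1)]]])
  moreover have "near_chrom_sf V E \<in> Gamma" using sf_alg_superset[of S] S(3) q(1) G(2) by auto
  ultimately have "near_chrom_sf V E = Y_star n \<or> n = 3 \<and> near_chrom_sf V E = Y_C3"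
    using q(3) odd_pos[OF n] by (intro near_chrom_sf_generator_cases[OF G(1)]) auto
  then show ?thesis using q(1) G(2) by auto
qed

section \<open>The two generating sets and their uniqueness\<close>

theorem mainTheorem5:
  defines "A \<equiv> {Y_star 1, Y_C3} \<union> {Y_star n | n. odd n \<and> 5 \<le> n}"
      and "B \<equiv> {Y_star n | n. odd n}"
  shows "alg_indep A \<and> sf_alg A = Gamma \<and> alg_indep B \<and> sf_alg B = Gamma \<and>
         (\<forall>S. S \<subseteq> {near_chrom_sf V E | V E. simple_graph V E} \<and> alg_indep S \<and> sf_alg S = Gamma
              \<longrightarrow> S = A \<or> S = B)"
proof -
  \<comment> \<open>Indexing the first set by all odd \<open>n\<close>, with the triangle in place
    of the star at \<open>n = 3\<close>, lets both sets go through
    \<open>near_chrom_sf_family\<close>.\<close>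
  let ?V = "\<lambda>n. if n = 3 then C3_V else star_V n" and ?E = "\<lambda>n. if n = 3 then C3_E else star_E n"
  have odd_cases: "n = 1 \<or> n = 3 \<or> 5 \<le> n" if "odd n" for n :: nat
    using that by presburger
  have A: "A = (\<lambda>n. near_chrom_sf (?V n) (?E n)) ` {n. odd n}" (is "_ = ?f ` _")
  proof
    have "?f 1 = Y_star 1" "?f 3 = Y_C3" "\<And>n. 5 \<le> n \<Longrightarrow> ?f n = Y_star n"
      by (simp_all add: Y_star_def Y_C3_def)
    moreover have "?f 1 \<in> ?f ` {n. odd n}" "?f 3 \<in> ?f ` {n. odd n}" by (rule imageI; simp)+
    moreover have "?f n \<in> ?f ` {n. odd n}" if "odd n" for n using that by (intro imageI) simp
    ultimately show "A \<subseteq> ?f ` {n. odd n}" unfolding A_def by fastforce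
    show "?f ` {n. odd n} \<subseteq> A"
    proof (rule image_subsetI)
      fix n :: nat assume n: "n \<in> {n. odd n}"
      then consider "n = 1" | "n = 3" | "5 \<le> n" using odd_cases by auto
      then show "?f n \<in> A"
      proof cases
        case 3
        then have "?f n = Y_star n" by (simp add: Y_star_def)
        then show ?thesis using 3 n by (auto simp: A_def)
      qed (simp_all add: A_def Y_star_def Y_C3_def)
    qed
  qed
  have B: "B = (\<lambda>n. near_chrom_sf (star_V n) (star_E n)) ` {n. odd n}"
    by (auto simp: B_def Y_star_def)
  have family_A: "simple_graph (?V n) (?E n)" "card (?V n) = n"
      "parts_in {r. odd r} (near_poly (?V n) (?E n))" "coeff (near_poly (?V n) (?E n)) {#n#} \<noteq> 0"
    if "odd n" for n
    using that odd_pos[OF that] by (simp_all add: simple_graph_C3 simple_graph_star near_poly_C3_odd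
        near_poly_star_odd coeff_near_poly_C3 coeff_near_poly_star)
      (simp add: C3_V_def star_V_def)
  have family_B: "simple_graph (star_V n) (star_E n)" "card (star_V n) = n"
      "parts_in {r. odd r} (near_poly (star_V n) (star_E n))" "coeff (near_poly (star_V n) (star_E n)) {#n#} \<noteq> 0"
    if "odd n" for n
    using that odd_pos[OF that]
    by (simp_all add: simple_graph_star near_poly_star_odd coeff_near_poly_star) (simp add: star_V_def)
  have indep_A: "alg_indep A"
    unfolding A by (rule near_chrom_sf_family(1)) (fact family_A)+
  have gen_A: "sf_alg A = Gamma"
    unfolding A by (rule near_chrom_sf_family(2)) (fact family_A)+
  have indep_B: "alg_indep B"
    unfolding B by (rule near_chrom_sf_family(1)) (fact family_B)+
  have gen_B: "sf_alg B = Gamma"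
    unfolding B by (rule near_chrom_sf_family(2)) (fact family_B)+
  have "S = A \<or> S = B"
    if S: "S \<subseteq> {near_chrom_sf V E | V E. simple_graph V E}" "alg_indep S" "sf_alg S = Gamma" for S
  proof -
    note mem = near_chrom_generating_set_contains[OF S]
    have S_Gamma: "S \<subseteq> Gamma" using sf_alg_superset[of S] S(3) by simp
    show ?thesis
    \<comment> \<open>Only \<open>n = 3\<close> leaves a choice. Once one of the two sets lies in
      \<open>S\<close>, it already generates \<open>Gamma\<close>, and independence leaves no room
      for further elements.\<close>
    proof (cases "Y_star 3 \<in> S")
      case True
      have "B \<subseteq> S"
      proof
        fix s assume "s \<in> B"
        then obtain n where "odd n" "s = Y_star n" by (auto simp: B_def)
        then show "s \<in> S" using mem True by blast
      qed
      then show ?thesis using alg_indep_generated_eq[OF S(2), of B] S_Gamma gen_B by simp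
    next
      case False
      then have "Y_C3 \<in> S" using mem[of 3] by simp
      moreover have "Y_star n \<in> S" if "odd n" "n \<noteq> 3" for n using mem that by blast
      ultimately have "A \<subseteq> S" by (auto simp: A_def)
      then show ?thesis using alg_indep_generated_eq[OF S(2), of A] S_Gamma gen_A by simp
    qed
  qed
  then show ?thesis using indep_A gen_A indep_B gen_B by blast
qed

end
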